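(* Let $G$ be a nilpotent subgroup of $\mathrm{Homeo}(\mathbb{T}^2)$ and suppose that $[G]$ has one of the following forms: $[G]=\{\mathrm{Id}\}$; $[G]=\langle D\rangle$ where $D$ is a non-trivial Dehn twist; $[G]=\langle A\rangle$ or $[G]=\langle A,-\mathrm{Id}\rangle$ where $\mathrm{spec}(A)$ does not contain any eigenvalue of modulus $1$. Then $\mathcal{I}_G=G_{\mathcal{I}}$.
   Context: $\mathbb{T}^2=\mathbb{R}^2/\mathbb{Z}^2$. For $\psi\in\mathrm{Homeo}(\mathbb{T}^2)$, $[\psi]\in\mathrm{MCG}(\mathbb{T}^2)=\mathrm{GL}(2,\mathbb{Z})$ is its mapping class (orientation-reversing classes are allowed), and $[G]=\{[\psi]:\psi\in G\}$. A non-trivial Dehn twist is a matrix conjugate in $\mathrm{GL}(2,\mathbb{Z})$ to $\begin{pmatrix}1&0\\ m&1\end{pmatrix}$ with $0\neq m\in\mathbb{Z}$. $G_0$ is the subgroup of elements of $G$ isotopic to the identity. $\mathcal{P}(\phi)$ is the set of $\phi$-invariant Borel probability measures on $\mathbb{T}^2$ and $\mathcal{P}(G)=\bigcap_{\psi\in G}\mathcal{P}(\psi)$. "Lift" means lift to the universal covering $\mathbb{R}^2$. For $\phi$ isotopic to the identity with lift $\tilde\phi$ and $\mu\in\mathcal{P}(\phi)$, $\rho_\mu(\tilde\phi):=\int_{\mathbb{T}^2}(\tilde\phi-\mathrm{Id})\,d\mu\in\mathbb{R}^2$ (note $\tilde\phi-\mathrm{Id}$ is well defined on $\mathbb{T}^2$).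 $\mathcal{I}_G:=\{\phi\in G_0 : \exists\text{ a lift }\tilde\phi\text{ of }\phi\text{ with }\rho_\mu(\tilde\phi)=(0,0)\text{ for all }\mu\in\mathcal{P}(\phi)\}$. $G_{\mathcal{I}}:=\{\phi\in G_0 : \exists\text{ a lift }\tilde\phi\text{ of }\phi\text{ with }\rho_\mu(\tilde\phi)=(0,0)\text{ for all }\mu\in\mathcal{P}(G)\}$. *)

theory Defs
  imports "HOL-Analysis.Analysis" "HOL-Probability.Probability_Measure"
    "HOL-Algebra.Generated_Groups"
begin

section \<open>The torus\<close>

definition torus_rel :: "real^2 \<Rightarrow> real^2 \<Rightarrow> bool" where
  "torus_rel x y \<longleftrightarrow> (\<forall>i. (x - y) $ i \<in> \<int>)"

lemma equivp_torus_rel: "equivp torus_rel"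
proof (rule equivpI)
  show "reflp torus_rel" by (simp add: reflp_def torus_rel_def)
  show "symp torus_rel"
    unfolding symp_def torus_rel_def
    by (metis Ints_minus minus_diff_eq vector_minus_component vector_uminus_component)
  show "transp torus_rel"
  proof (rule transpI)
    fix x y z assume "torus_rel x y" "torus_rel y z"
    then have "(x - y) $ i + (y - z) $ i \<in> \<int>" for i
      unfolding torus_rel_def by (blast intro: Ints_add)
    then show "torus_rel x z" by (simp add: torus_rel_def)
  qed
qed

quotient_type torus = "real^2" / torus_rel
  by (rule equivp_torus_rel)

instantiation torus :: topological_space
begin

definition open_torus :: "torus set \<Rightarrow> bool" where
  "open_torus U \<longleftrightarrow> open (abs_torus -` U)"

instance
proof
  show "open (UNIV :: torus set)" by (simp add: open_torus_def)
  show "open (S \<inter> T)" if "open S" "open T" for S T :: "torus set"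
    using that by (simp add: open_torus_def vimage_Int open_Int)
  show "open (\<Union>K)" if "\<forall>S\<in>K. open S" for K :: "torus set set"
    using that by (auto simp: open_torus_def vimage_Union intro!: open_UN)
qed

end

abbreviation torus_proj :: "real^2 \<Rightarrow> torus" where
  "torus_proj \<equiv> abs_torus"

lemma torus_proj_eq_iff: "torus_proj x = torus_proj y \<longleftrightarrow> (\<forall>i. (x - y) $ i \<in> \<int>)"
  using torus.abs_eq_iff torus_rel_def by simp

lemma torus_proj_rep [simp]: "torus_proj (rep_torus p) = p"
  by (rule Quotient_abs_rep[OF Quotient_torus])

lemma continuous_on_torus_proj: "continuous_on UNIV torus_proj"
  by (simp add: continuous_on_open_vimage open_torus_def)

section \<open>Homeomorphisms, isotopies and mapping classes\<close>

definition Homeo :: "(torus \<Rightarrow> torus) monoid" where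
  "Homeo = \<lparr>carrier = {f. \<exists>g. homeomorphism UNIV UNIV f g}, mult = (\<circ>), one = id\<rparr>"

lemma group_Homeo: "group Homeo"
proof (rule groupI)
  show "x \<otimes>\<^bsub>Homeo\<^esub> y \<in> carrier Homeo"
    if "x \<in> carrier Homeo" "y \<in> carrier Homeo" for x y
    using that by (auto simp: Homeo_def intro: homeomorphism_compose)
  show "\<one>\<^bsub>Homeo\<^esub> \<in> carrier Homeo"
    by (auto simp: Homeo_def homeomorphism_def intro!: exI[of _ id])
  show "\<exists>y\<in>carrier Homeo. y \<otimes>\<^bsub>Homeo\<^esub> x = \<one>\<^bsub>Homeo\<^esub>"
    if x: "x \<in> carrier Homeo" for x
  proof -
    obtain g where g: "homeomorphism UNIV UNIV x g" using x by (auto simp: Homeo_def)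
    then have "homeomorphism UNIV UNIV g x" by (rule homeomorphism_symD)
    moreover have "g \<circ> x = id" using g by (auto simp: homeomorphism_def)
    ultimately show ?thesis by (auto simp: Homeo_def)
  qed
qed (auto simp: Homeo_def)

definition isotopic :: "(torus \<Rightarrow> torus) \<Rightarrow> (torus \<Rightarrow> torus) \<Rightarrow> bool" where
  "isotopic f g \<longleftrightarrow> homotopic_with_canon (\<lambda>h. h \<in> carrier Homeo) UNIV UNIV f g"

definition mapping_class :: "(torus \<Rightarrow> torus) \<Rightarrow> (torus \<Rightarrow> torus) set" where
  "mapping_class f = {g. isotopic f g}"

definition GL2Z :: "(int^2^2) monoid" where
  "GL2Z = \<lparr>carrier = {A. invertible A}, mult = (**), one = mat 1\<rparr>"

lemma group_GL2Z: "group GL2Z"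
proof (rule groupI)
  show "x \<otimes>\<^bsub>GL2Z\<^esub> y \<in> carrier GL2Z"
    if "x \<in> carrier GL2Z" "y \<in> carrier GL2Z" for x y
    using that by (auto simp: GL2Z_def intro: invertible_mult)
  show "\<one>\<^bsub>GL2Z\<^esub> \<in> carrier GL2Z"
    by (auto simp: GL2Z_def invertible_def intro!: exI[of _ "mat 1"])
  show "\<exists>y\<in>carrier GL2Z. y \<otimes>\<^bsub>GL2Z\<^esub> x = \<one>\<^bsub>GL2Z\<^esub>"
    if "x \<in> carrier GL2Z" for x
    using that by (auto simp: GL2Z_def invertible_def)
qed (auto simp: GL2Z_def matrix_mul_assoc)

lift_definition toral_aut :: "int^2^2 \<Rightarrow> torus \<Rightarrow> torus"
  is "\<lambda>A x. map_matrix real_of_int A *v x"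
proof -
  fix A :: "int^2^2" and x y :: "real^2"
  assume "torus_rel x y"
  then show "torus_rel (map_matrix real_of_int A *v x) (map_matrix real_of_int A *v y)"
    unfolding torus_rel_def matrix_vector_mult_diff_distrib[symmetric]
    by (auto simp: matrix_vector_mult_def intro!: Ints_sum Ints_mult)
qed

lemma toral_aut_mult: "toral_aut (A ** B) p = toral_aut A (toral_aut B p)"
proof transfer
  fix A B :: "int^2^2" and x :: "real^2"
  have "map_matrix real_of_int (A ** B) = map_matrix real_of_int A ** map_matrix real_of_int B"
    by (simp add: vec_eq_iff matrix_matrix_mult_def)
  then show "torus_rel (map_matrix real_of_int (A ** B) *v x)
      (map_matrix real_of_int A *v (map_matrix real_of_int B *v x))"
    by (simp add: torus_rel_def matrix_vector_mul_assoc)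
qed

lemma toral_aut_one: "toral_aut (mat 1) p = p"
proof transfer
  fix x :: "real^2"
  have "map_matrix real_of_int (mat 1 :: int^2^2) = mat 1"
    by (simp add: vec_eq_iff mat_def)
  then show "torus_rel (map_matrix real_of_int (mat 1) *v x) x"
    by (simp add: torus_rel_def)
qed

lemma continuous_toral_aut: "continuous_on UNIV (toral_aut A)"
proof -
  have "open (toral_aut A -` U)" if "open U" for U
  proof -
    have "torus_proj -` (toral_aut A -` U) = (\<lambda>x. map_matrix real_of_int A *v x) -` (torus_proj -` U)"
      by (auto simp: toral_aut.abs_eq)
    moreover have "open (torus_proj -` U)" using that by (simp add: open_torus_def)
    ultimately show ?thesis
      unfolding open_torus_def[of "toral_aut A -` U"]
      using open_vimage[OF _ matrix_vector_mult_linear_continuous_on] by metis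
  qed
  then show ?thesis by (simp add: continuous_on_open_vimage)
qed

lemma toral_aut_in_Homeo: "A \<in> carrier GL2Z \<Longrightarrow> toral_aut A \<in> carrier Homeo"
proof -
  assume "A \<in> carrier GL2Z"
  then obtain B where B: "A ** B = mat 1" "B ** A = mat 1"
    by (auto simp: GL2Z_def invertible_def)
  have "homeomorphism UNIV UNIV (toral_aut A) (toral_aut B)"
    by (rule homeomorphismI)
      (auto simp: continuous_toral_aut toral_aut_mult[symmetric] B toral_aut_one)
  then show ?thesis by (auto simp: Homeo_def)
qed

text \<open>The identification of \<open>GL(2,\<int>)\<close> with the mapping class group of the torus sends a matrix
  to the isotopy class of the automorphism that it induces on \<open>\<real>\<^sup>2/\<int>\<^sup>2\<close>.\<close>

definition matrix_class :: "int^2^2 \<Rightarrow> (torus \<Rightarrow> torus) set" where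
  "matrix_class A = mapping_class (toral_aut A)"

definition dehn_twist :: "int^2^2 \<Rightarrow> bool" where
  "dehn_twist D \<longleftrightarrow> (\<exists>P \<in> carrier GL2Z. \<exists>m::int. m \<noteq> 0 \<and>
     D = P \<otimes>\<^bsub>GL2Z\<^esub> vector [vector [1, 0], vector [m, 1]] \<otimes>\<^bsub>GL2Z\<^esub> inv\<^bsub>GL2Z\<^esub> P)"

definition spec :: "int^2^2 \<Rightarrow> complex set" where
  "spec A = {c. \<exists>v::complex^2. v \<noteq> 0 \<and> map_matrix of_int A *v v = c *s v}"

section \<open>Nilpotency\<close>

primrec lower_central_series :: "('a, 'b) monoid_scheme \<Rightarrow> 'a set \<Rightarrow> nat \<Rightarrow> 'a set" where
  "lower_central_series G H 0 = H"
| "lower_central_series G H (Suc n) = generate G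
     (\<Union>x\<in>H. \<Union>y\<in>lower_central_series G H n. {x \<otimes>\<^bsub>G\<^esub> y \<otimes>\<^bsub>G\<^esub> inv\<^bsub>G\<^esub> x \<otimes>\<^bsub>G\<^esub> inv\<^bsub>G\<^esub> y})"

definition nilpotent_subgroup :: "'a set \<Rightarrow> ('a, 'b) monoid_scheme \<Rightarrow> bool" where
  "nilpotent_subgroup H G \<longleftrightarrow>
     subgroup H G \<and> (\<exists>n. lower_central_series G H n = {\<one>\<^bsub>G\<^esub>})"

section \<open>Invariant measures and rotation vectors\<close>

definition inv_measures :: "(torus \<Rightarrow> torus) \<Rightarrow> torus measure set" where
  "inv_measures \<phi> = {\<mu>. prob_space \<mu> \<and> sets \<mu> = sets borel \<and> distr \<mu> borel \<phi> = \<mu>}"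

definition group_inv_measures :: "(torus \<Rightarrow> torus) set \<Rightarrow> torus measure set" where
  "group_inv_measures G = (\<Inter>\<psi>\<in>G. inv_measures \<psi>)"

definition is_lift :: "(real^2 \<Rightarrow> real^2) \<Rightarrow> (torus \<Rightarrow> torus) \<Rightarrow> bool" where
  "is_lift F \<phi> \<longleftrightarrow> continuous_on UNIV F \<and> (\<forall>x. torus_proj (F x) = \<phi> (torus_proj x))"

text \<open>\<open>F - Id\<close> as a map on the torus. It is evaluated at a chosen representative; when \<open>F\<close> lifts a
  homeomorphism isotopic to the identity, \<open>F\<close> commutes with integer translations and the value does
  not depend on the choice.\<close>

definition displacement :: "(real^2 \<Rightarrow> real^2) \<Rightarrow> torus \<Rightarrow> real^2" where
  "displacement F p = F (rep_torus p) - rep_torus p"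

lemma displacement_torus_proj:
  assumes "\<And>x v. (\<forall>i. v $ i \<in> \<int>) \<Longrightarrow> F (x + v) = F x + v"
  shows "displacement F (torus_proj x) = F x - x"
proof -
  define v where "v = rep_torus (torus_proj x) - x"
  have "torus_proj (rep_torus (torus_proj x)) = torus_proj x" by simp
  then have "\<forall>i. v $ i \<in> \<int>" unfolding torus_proj_eq_iff v_def .
  from assms[OF this, of x] show ?thesis by (simp add: displacement_def v_def algebra_simps)
qed

definition rotation_vector :: "torus measure \<Rightarrow> (real^2 \<Rightarrow> real^2) \<Rightarrow> real^2" where
  "rotation_vector \<mu> F = (\<integral>p. displacement F p \<partial>\<mu>)"

definition isotopic_to_id_part :: "(torus \<Rightarrow> torus) set \<Rightarrow> (torus \<Rightarrow> torus) set" where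
  "isotopic_to_id_part G = {\<phi>\<in>G. isotopic \<phi> id}"

text \<open>\<open>irrotational G\<close> is \<open>\<I>\<^sub>G\<close> and \<open>group_irrotational G\<close> is \<open>G\<^sub>\<I>\<close>.\<close>

definition irrotational :: "(torus \<Rightarrow> torus) set \<Rightarrow> (torus \<Rightarrow> torus) set" where
  "irrotational G = {\<phi> \<in> isotopic_to_id_part G.
     \<exists>F. is_lift F \<phi> \<and> (\<forall>\<mu>\<in>inv_measures \<phi>. rotation_vector \<mu> F = 0)}"

definition group_irrotational :: "(torus \<Rightarrow> torus) set \<Rightarrow> (torus \<Rightarrow> torus) set" where
  "group_irrotational G = {\<phi> \<in> isotopic_to_id_part G.
     \<exists>F. is_lift F \<phi> \<and> (\<forall>\<mu>\<in>group_inv_measures G. rotation_vector \<mu> F = 0)}"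

end

theory Submission
  imports Defs
begin

text \<open>Let \<open>F\<close> be a lift of \<open>\<phi> \<in> G\<close>, where \<open>\<phi>\<close> is isotopic to the identity. The point is that every rotation
  vector of \<open>F\<close> with respect to a \<open>\<phi>\<close>-invariant measure is also attained at a \<open>G\<close>-invariant measure.
  Starting from \<open>\<mu> \<in> \<P>(\<phi>)\<close> one climbs the lower central series: the group \<open>\<Gamma>\<^sub>j\<close> acts on the compact
  convex set of means invariant under \<open>\<phi>\<close> and \<open>\<Gamma>\<^sub>j\<^sub>+\<^sub>1\<close> by commuting affine maps, so it has a fixed point
  by Markov and Kakutani, and it remains to see that this action does not change the rotation vector.

  If \<open>\<psi>\<close> acts on \<open>\<int>\<^sup>2\<close> by \<open>B\<close> and \<open>e\<psi> = \<psi>ee'\<close>, then \<open>\<rho>(\<psi>\<^sub>*\<mu>, e) = B(\<rho>(\<mu>, e) + \<rho>(\<mu>, e')) + w\<close> with a constant \<open>w\<close>.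
  By nilpotency the claim may be assumed for the commutator \<open>e'\<close>. If \<open>B\<close> is unipotent, the vectors
  \<open>\<rho>(\<psi>\<^sup>k\<^sub>*\<mu>, e)\<close> form a bounded polynomial sequence, hence a constant one. If \<open>B\<close> is hyperbolic, the bounded
  set of differences \<open>\<rho>(\<mu>, e) - \<rho>(\<mu>', e)\<close> is \<open>B\<close>-invariant, hence zero. Elements of \<open>\<Gamma>\<^sub>j\<close>, \<open>j \<ge> 1\<close>, act
  trivially on \<open>\<int>\<^sup>2\<close> because the group of mapping classes is commutative.

  Means are used instead of measures so that compactness is Tychonoff's theorem; a Caratheodory
  construction turns the final invariant mean into a measure.\<close>

section \<open>Common fixed points of commuting maps\<close>

text \<open>The elements of \<open>K\<close> will be means, so \<open>'x\<close> stands for a space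
  of functions on the torus. The maps acting on \<open>K\<close> are precompositions with some
  \<open>\<tau> :: 'x \<Rightarrow> 'x\<close>; these are affine and continuous for pointwise
  convergence.\<close>

definition convex_functions :: "('x \<Rightarrow> real) set \<Rightarrow> bool" where
  "convex_functions K \<longleftrightarrow>
     (\<forall>L\<in>K. \<forall>L'\<in>K. \<forall>t\<in>{0..1}. (\<lambda>x. (1 - t) * L x + t * L' x) \<in> K)"

lemma closed_eq_eval:
  fixes x y :: 'x
  shows "closed {L :: 'x \<Rightarrow> real. L x = L y}" "closed {L :: 'x \<Rightarrow> real. L x = c}"
  by (intro closed_Collect_eq continuous_on_product_coordinates continuous_on_const)+

lemma closed_fixed_functions: "closed {L :: 'x \<Rightarrow> real. L \<circ> \<tau> = L}"
proof -
  have "{L :: 'x \<Rightarrow> real. L \<circ> \<tau> = L} = (\<Inter>x. {L. L (\<tau> x) = L x})"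
    by (auto simp: fun_eq_iff)
  then show ?thesis by (auto intro!: closed_INT closed_eq_eval)
qed

text \<open>The average of \<open>n + 2\<close> iterates is a convex combination of the last
  iterate, with weight \<open>1 / (n + 2)\<close>, and the average of the others.\<close>

lemma average_in_convex_functions:
  assumes "convex_functions K" "\<And>L. L \<in> K \<Longrightarrow> L \<circ> \<tau> \<in> K" "L \<in> K"
  shows "(\<lambda>x. (\<Sum>k\<le>n. L ((\<tau> ^^ k) x)) / real (n + 1)) \<in> K"
proof (induction n)
  case 0 then show ?case using assms(3) by simp
next
  case (Suc n)
  have pow: "(\<lambda>x. L ((\<tau> ^^ k) x)) \<in> K" for k
  proof (induction k)
    case (Suc k)
    from assms(2)[OF this] show ?case by (simp add: comp_def funpow_swap1)
  qed (use assms(3) in simp)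
  define t where "t = 1 / real (n + 2)"
  have t: "t \<in> {0..1}" by (simp add: t_def)
  have "(\<lambda>x. (1 - t) * ((\<Sum>k\<le>n. L ((\<tau> ^^ k) x)) / real (n + 1)) + t * L ((\<tau> ^^ Suc n) x)) \<in> K"
    using assms(1)[unfolded convex_functions_def, THEN bspec, OF Suc, THEN bspec, OF pow[of "Suc n"],
        THEN bspec, OF t] .
  moreover have "(1 - t) * (s / real (n + 1)) + t * u = (s + u) / real (Suc n + 1)" for s u
  proof -
    have "1 - t = real (n + 1) / real (n + 2)" by (simp add: t_def field_simps)
    then have "(1 - t) * (s / real (n + 1)) = s / real (n + 2)" by (simp del: of_nat_add)
    then show ?thesis by (simp add: t_def add_divide_distrib)
  qed
  ultimately show ?case by simp
qed

text \<open>At each \<open>x\<close> the averages of an orbit are invariant up to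
  \<open>2 * C x / (n + 1)\<close>, because the difference telescopes. The closed sets
  \<open>S n\<close> express these bounds and decrease, so compactness yields an element of
  \<open>K\<close> in all of them, which is a fixed point.\<close>

lemma markov_kakutani_single:
  fixes K :: "('x \<Rightarrow> real) set"
  assumes "compact K" "K \<noteq> {}" and conv: "convex_functions K"
    and inv: "\<And>L. L \<in> K \<Longrightarrow> L \<circ> \<tau> \<in> K"
  shows "\<exists>L\<in>K. L \<circ> \<tau> = L"
proof -
  obtain L0 where L0: "L0 \<in> K" using assms by auto
  have "\<exists>C. \<forall>L\<in>K. \<bar>L x\<bar> \<le> C" for x
  proof -
    have "compact ((\<lambda>L. L x) ` K)"
      by (rule compact_continuous_image[OF continuous_on_subset[OF continuous_on_product_coordinates] \<open>compact K\<close>]) auto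
    then have "bounded ((\<lambda>L. L x) ` K)" by (rule compact_imp_bounded)
    then show ?thesis by (auto simp: bounded_iff)
  qed
  then obtain C where C: "\<And>L x. L \<in> K \<Longrightarrow> \<bar>L x\<bar> \<le> C x" by metis
  define A where "A n = (\<lambda>x. (\<Sum>k\<le>n. L0 ((\<tau> ^^ k) x)) / real (n + 1))" for n
  have A: "A n \<in> K" for n
    unfolding A_def by (rule average_in_convex_functions[OF conv inv L0])
  have pow: "L0 \<circ> \<tau> ^^ k \<in> K" for k
  proof (induction k)
    case (Suc k)
    from inv[OF this] show ?case by (simp add: comp_def funpow_swap1)
  qed (use L0 in simp)
  define S where "S n = {L. \<forall>x. \<bar>L (\<tau> x) - L x\<bar> * real (n + 1) \<le> 2 * C x}" for n :: nat
  have cl: "closed (S n)" for n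
  proof -
    have "S n = (\<Inter>x. {L. \<bar>L (\<tau> x) - L x\<bar> * real (n + 1) \<le> 2 * C x})"
      by (auto simp: S_def)
    then show ?thesis
      by (auto intro!: closed_INT closed_Collect_le continuous_intros continuous_on_product_coordinates)
  qed
  have mem: "A n \<in> S n" for n
    unfolding S_def
  proof (intro CollectI allI)
    fix x
    have "A n (\<tau> x) - A n x = ((\<Sum>k\<le>n. L0 ((\<tau> ^^ Suc k) x)) - (\<Sum>k\<le>n. L0 ((\<tau> ^^ k) x))) / real (n + 1)"
      by (simp add: A_def diff_divide_distrib funpow_swap1)
    also have "(\<Sum>k\<le>n. L0 ((\<tau> ^^ Suc k) x)) - (\<Sum>k\<le>n. L0 ((\<tau> ^^ k) x)) = L0 ((\<tau> ^^ Suc n) x) - L0 x"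
      using sum_telescope[of "\<lambda>k. - L0 ((\<tau> ^^ k) x)" n] by (simp add: sum_subtractf[symmetric])
    finally have "\<bar>A n (\<tau> x) - A n x\<bar> * real (n + 1) = \<bar>L0 ((\<tau> ^^ Suc n) x) - L0 x\<bar>"
      by (simp add: abs_mult)
    also have "\<dots> \<le> 2 * C x"
      using C[OF pow[of "Suc n"], of x] C[OF L0, of x] by (simp add: comp_def)
    finally show "\<bar>A n (\<tau> x) - A n x\<bar> * real (n + 1) \<le> 2 * C x" .
  qed
  have mono: "S m \<subseteq> S n" if "n \<le> m" for n m
  proof
    fix L assume L: "L \<in> S m"
    have "\<bar>L (\<tau> x) - L x\<bar> * real (n + 1) \<le> \<bar>L (\<tau> x) - L x\<bar> * real (m + 1)" for x
      using that by (intro mult_left_mono) auto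
    with L show "L \<in> S n" unfolding S_def by (blast intro: order_trans)
  qed
  have "K \<inter> (\<Inter>n\<in>UNIV. S n) \<noteq> {}"
  proof (rule compact_imp_fip_image[OF \<open>compact K\<close>])
    fix I :: "nat set" assume "finite I"
    \<comment> \<open>The average with the largest index serves all of \<open>I\<close>, since the
      \<open>S n\<close> decrease; inserting \<open>0\<close> covers an empty
      \<open>I\<close>.\<close>
    then have "A (Max (insert 0 I)) \<in> S n" if "n \<in> I" for n
      using mono[of n "Max (insert 0 I)"] mem that by (meson Max_ge finite_insert insertI2 subsetD)
    then show "K \<inter> (\<Inter>n\<in>I. S n) \<noteq> {}" using A by blast
  qed (use cl in auto)
  then obtain L where L: "L \<in> K" "\<And>n. L \<in> S n" by auto
  have "L (\<tau> x) = L x" for x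
  proof (rule ccontr)
    assume "L (\<tau> x) \<noteq> L x"
    then obtain n :: nat where "2 * C x < real n * \<bar>L (\<tau> x) - L x\<bar>"
      using reals_Archimedean3[of "\<bar>L (\<tau> x) - L x\<bar>"] by auto
    moreover have "\<bar>L (\<tau> x) - L x\<bar> * real (n + 1) \<le> 2 * C x"
      using L(2)[of n] by (auto simp: S_def)
    ultimately show False by (simp add: algebra_simps)
  qed
  with L(1) show ?thesis by (auto simp: fun_eq_iff)
qed

text \<open>Commutation is asked for only after an element of \<open>K\<close> has been applied;
  this suits the later use, where elements of \<open>K\<close> absorb commutators. Finitely many
  maps are treated one at a time, since each preserves the compact convex set fixed by the others;
  compactness then covers all of \<open>\<Theta>\<close>.\<close>

theorem markov_kakutani:
  fixes K :: "('x \<Rightarrow> real) set"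
  assumes "compact K" "K \<noteq> {}" and conv: "convex_functions K"
    and inv: "\<And>L \<tau>. L \<in> K \<Longrightarrow> \<tau> \<in> \<Theta> \<Longrightarrow> L \<circ> \<tau> \<in> K"
    and comm: "\<And>L \<sigma> \<tau>. L \<in> K \<Longrightarrow> \<sigma> \<in> \<Theta> \<Longrightarrow> \<tau> \<in> \<Theta> \<Longrightarrow> L \<circ> \<sigma> \<circ> \<tau> = L \<circ> \<tau> \<circ> \<sigma>"
  shows "\<exists>L\<in>K. \<forall>\<tau>\<in>\<Theta>. L \<circ> \<tau> = L"
proof -
  have fin: "\<exists>L\<in>K. \<forall>\<tau>\<in>T. L \<circ> \<tau> = L" if "finite T" "T \<subseteq> \<Theta>" for T
    using that
  proof (induction T rule: finite_induct)
    case empty then show ?case using assms(2) by auto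
  next
    case (insert \<sigma> T)
    define K' where "K' = K \<inter> (\<Inter>\<tau>\<in>T. {L. L \<circ> \<tau> = L})"
    have "\<exists>L\<in>K'. L \<circ> \<sigma> = L"
    proof (rule markov_kakutani_single)
      show "compact K'"
        unfolding K'_def by (intro compact_Int_closed \<open>compact K\<close> closed_INT ballI closed_fixed_functions)
      obtain L where "L \<in> K" "\<forall>\<tau>\<in>T. L \<circ> \<tau> = L"
        using insert.IH insert.prems by blast
      then have "L \<in> K'" by (simp add: K'_def)
      then show "K' \<noteq> {}" by blast
      show "convex_functions K'"
        using conv unfolding convex_functions_def K'_def
        by (auto simp: fun_eq_iff)
      fix L assume "L \<in> K'"
      then have L: "L \<in> K" "\<And>\<tau>. \<tau> \<in> T \<Longrightarrow> L \<circ> \<tau> = L" by (auto simp: K'_def)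
      have "L \<circ> \<sigma> \<circ> \<tau> = L \<circ> \<sigma>" if "\<tau> \<in> T" for \<tau>
        using comm[OF L(1), of \<sigma> \<tau>] L(2)[OF that] that insert.prems by auto
      then show "L \<circ> \<sigma> \<in> K'" using inv[OF L(1)] insert.prems by (auto simp: K'_def)
    qed
    then show ?case unfolding K'_def by blast
  qed
  have "K \<inter> (\<Inter>\<tau>\<in>\<Theta>. {L. L \<circ> \<tau> = L}) \<noteq> {}"
  proof (rule compact_imp_fip_image[OF \<open>compact K\<close> closed_fixed_functions])
    fix T assume "finite T" "T \<subseteq> \<Theta>"
    from fin[OF this] show "K \<inter> (\<Inter>\<tau>\<in>T. {L. L \<circ> \<tau> = L}) \<noteq> {}" by auto
  qed
  then show ?thesis by auto
qed

section \<open>Lifts of torus maps\<close>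

lemma cis_2pi_eq_iff: "cis (2 * pi * a) = cis (2 * pi * b) \<longleftrightarrow> a - b \<in> \<int>"
proof -
  have "cis (2 * pi * a) = cis (2 * pi * b) \<longleftrightarrow> (\<exists>n::int. a = b + of_int n)"
  proof -
    have "2 * pi * a = 2 * pi * b + 2 * pi * of_int n \<longleftrightarrow> a = b + of_int n" for n
      by (simp flip: distrib_left)
    then show ?thesis
      unfolding cis_conv_exp exp_eq by (simp add: complex_eq_iff algebra_simps)
  qed
  also have "\<dots> \<longleftrightarrow> a - b \<in> \<int>"
    by (auto elim!: Ints_cases simp: algebra_simps)
  finally show ?thesis .
qed

lemma continuous_on_torusI:
  assumes "continuous_on UNIV (\<lambda>x. f (torus_proj x))"
  shows "continuous_on UNIV f"
  unfolding continuous_on_open_vimage[OF open_UNIV]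
proof (intro allI impI)
  fix U :: "'a set" assume "open U"
  with assms have "open ((\<lambda>x. f (torus_proj x)) -` U)"
    by (simp add: continuous_on_open_vimage)
  then show "open (f -` U \<inter> UNIV)" by (simp add: open_torus_def vimage_def)
qed

lemma surj_torus_proj: "surj torus_proj"
  by (metis surjI torus_proj_rep)

section \<open>The torus as a product of two circles, and its metric\<close>

definition torus_emb :: "torus \<Rightarrow> complex \<times> complex" where
  "torus_emb p = (cis (2 * pi * (rep_torus p $ 1)), cis (2 * pi * (rep_torus p $ 2)))"

lemma torus_emb_proj:
  "torus_emb (torus_proj x) = (cis (2 * pi * (x $ 1)), cis (2 * pi * (x $ 2)))"
  using torus_proj_rep[of "torus_proj x"]
  by (simp add: torus_emb_def torus_proj_eq_iff cis_2pi_eq_iff del: torus_proj_rep)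

lemma inj_torus_emb: "torus_emb p = torus_emb q \<Longrightarrow> p = q"
  using torus_proj_eq_iff[of "rep_torus p" "rep_torus q"]
  by (simp add: torus_emb_def cis_2pi_eq_iff forall_2)

lemma continuous_torus_emb: "continuous_on UNIV torus_emb"
  by (rule continuous_on_torusI) (auto simp: torus_emb_proj intro!: continuous_intros)

lemma compact_torus: "compact (UNIV :: torus set)"
proof -
  have "\<exists>x\<in>cbox 0 1. torus_proj x = p" for p
  proof (rule bexI)
    define x :: "real^2" where "x = (\<chi> i. frac (rep_torus p $ i))"
    show "x \<in> cbox 0 1"
      by (auto simp: x_def mem_box_cart frac_ge_0 frac_lt_1 less_imp_le)
    have "torus_proj x = torus_proj (rep_torus p)"
      unfolding torus_proj_eq_iff by (simp add: x_def frac_def)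
    then show "torus_proj x = p" by simp
  qed
  then have "UNIV = torus_proj ` cbox 0 1" by (auto simp: image_iff Bex_def) metis
  then show ?thesis
    by (metis compact_cbox compact_continuous_image continuous_on_subset continuous_on_torus_proj subset_UNIV)
qed

text \<open>The quotient topology is fixed beforehand, so the pulled-back metric has to be shown to
  induce it. The metric serves the representation of means by measures, which uses closed balls
  inside open sets.\<close>

instantiation torus :: metric_space
begin

definition dist_torus :: "torus \<Rightarrow> torus \<Rightarrow> real" where
  "dist_torus p q = dist (torus_emb p) (torus_emb q)"

definition uniformity_torus :: "(torus \<times> torus) filter" where
  "uniformity_torus = (INF e\<in>{0<..}. principal {(x, y). dist x y < e})"

instance
proof
  show uni: "uniformity = (INF e\<in>{0<..}. principal {(x::torus, y). dist x y < e})"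
    by (rule uniformity_torus_def)
  show "dist x y = 0 \<longleftrightarrow> x = y" for x y :: torus
    using inj_torus_emb by (auto simp: dist_torus_def)
  show "dist x y \<le> dist x z + dist y z" for x y z :: torus
    by (simp add: dist_torus_def dist_triangle2)
  have ev: "eventually P uniformity \<longleftrightarrow> (\<exists>e>0. \<forall>x y::torus. dist x y < e \<longrightarrow> P (x, y))" for P
    unfolding uni by (subst eventually_INF_base)
      (auto simp: eventually_principal subset_eq intro: bexI[of _ "min _ _"])
  fix U :: "torus set"
  have "open U \<longleftrightarrow> (\<forall>x\<in>U. \<exists>e>0. \<forall>y. dist x y < e \<longrightarrow> y \<in> U)"
  proof
    \<comment> \<open>The complement of \<open>U\<close> is compact, so its image is closed; as the
      embedding is injective, a ball around \<open>torus_emb x\<close> misses this image.\<close>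
    assume "open U"
    then have "compact (UNIV \<inter> - U)"
      by (intro compact_Int_closed compact_torus) (simp add: closed_def)
    then have "compact (torus_emb ` (- U))"
      using compact_continuous_image[OF continuous_on_subset[OF continuous_torus_emb]] by simp
    then have op: "open (- (torus_emb ` (- U)))"
      using compact_imp_closed by (simp add: open_closed)
    show "\<forall>x\<in>U. \<exists>e>0. \<forall>y. dist x y < e \<longrightarrow> y \<in> U"
    proof
      fix x assume "x \<in> U"
      then have "torus_emb x \<in> - (torus_emb ` (- U))" using inj_torus_emb by auto
      then obtain e where "e > 0" "ball (torus_emb x) e \<subseteq> - (torus_emb ` (- U))"
        using op openE by blast
      then show "\<exists>e>0. \<forall>y. dist x y < e \<longrightarrow> y \<in> U"
        by (intro exI[of _ e]) (auto simp: dist_torus_def subset_eq)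
    qed
  next
    assume U: "\<forall>x\<in>U. \<exists>e>0. \<forall>y. dist x y < e \<longrightarrow> y \<in> U"
    have "\<exists>T. open T \<and> x \<in> T \<and> T \<subseteq> U" if x: "x \<in> U" for x
    proof -
      obtain e where "e > 0" "\<forall>y. dist x y < e \<longrightarrow> y \<in> U" using U x by blast
      then show ?thesis
        using continuous_torus_emb
        by (intro exI[of _ "torus_emb -` ball (torus_emb x) e"])
          (auto simp: continuous_on_open_vimage dist_torus_def)
    qed
    then show "open U" by (subst open_subopen) blast
  qed
  also have "\<dots> \<longleftrightarrow> (\<forall>x\<in>U. \<forall>\<^sub>F (x', y) in uniformity. x' = x \<longrightarrow> y \<in> U)"
    unfolding ev prod.case by blast
  finally show "open U \<longleftrightarrow> (\<forall>x\<in>U. \<forall>\<^sub>F (x', y) in uniformity. x' = x \<longrightarrow> y \<in> U)" .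
qed

end

text \<open>Both circle coordinates of \<open>f\<close> are nowhere zero, so they have continuous
  logarithms on a contractible set. Their imaginary parts divided by \<open>2 * pi\<close> are the
  coordinates of the lift.\<close>

lemma torus_lift_exists:
  fixes f :: "'a::real_normed_vector \<Rightarrow> torus"
  assumes f: "continuous_on S f" and S: "contractible S"
  obtains F :: "'a \<Rightarrow> real^2"
  where "continuous_on S F" "\<And>x. x \<in> S \<Longrightarrow> torus_proj (F x) = f x"
proof -
  have ce: "continuous_on S (\<lambda>x. torus_emb (f x))"
    by (rule continuous_on_compose2[OF continuous_torus_emb f]) simp
  have n1: "cmod (fst (torus_emb p)) = 1" "cmod (snd (torus_emb p)) = 1" for p
    by (simp_all add: torus_emb_def)
  have nz: "fst (torus_emb p) \<noteq> 0" "snd (torus_emb p) \<noteq> 0" for p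
    using n1[of p] by auto
  obtain g1 where g1: "continuous_on S g1" "\<And>x. x \<in> S \<Longrightarrow> fst (torus_emb (f x)) = exp (g1 x)"
    using continuous_logarithm_on_contractible[OF continuous_on_fst[OF ce] S nz(1)] by metis
  obtain g2 where g2: "continuous_on S g2" "\<And>x. x \<in> S \<Longrightarrow> snd (torus_emb (f x)) = exp (g2 x)"
    using continuous_logarithm_on_contractible[OF continuous_on_snd[OF ce] S nz(2)] by metis
  have ex: "exp z = cis (Im z)" if "cmod (exp z) = 1" for z
  proof -
    have "exp (Re z) = 1" using that by (simp only: norm_exp_eq_Re)
    then show ?thesis using exp_eq_polar[of z] by simp
  qed
  define F :: "'a \<Rightarrow> real^2" where "F x = (\<chi> i. if i = 1 then Im (g1 x) / (2 * pi) else Im (g2 x) / (2 * pi))" for x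
  show thesis
  proof
    have "continuous_on S (\<lambda>x. F x $ i)" for i
      unfolding F_def using g1(1) g2(1) by (cases "i = 1") (auto intro!: continuous_intros)
    then have "continuous_on S (\<lambda>x. \<chi> i. F x $ i)" by (rule continuous_on_vec_lambda)
    then show "continuous_on S F" by simp
    fix x assume x: "x \<in> S"
    have "torus_emb (torus_proj (F x)) = torus_emb (f x)"
      using g1(2)[OF x] g2(2)[OF x] n1[of "f x"] ex[of "g1 x"] ex[of "g2 x"]
      by (simp add: torus_emb_proj F_def prod_eq_iff)
    then show "torus_proj (F x) = f x" by (rule inj_torus_emb)
  qed
qed

lemma continuous_integer_vector_constant:
  fixes f :: "'a::topological_space \<Rightarrow> real^'n"
  assumes "connected S" "continuous_on S f" "\<And>x i. x \<in> S \<Longrightarrow> f x $ i \<in> \<int>"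
  shows "f constant_on S"
proof -
  have "(\<lambda>x. f x $ i) constant_on S" for i
  proof (rule continuous_discrete_range_constant[OF assms(1)])
    show "continuous_on S (\<lambda>x. f x $ i)" using assms(2) by (intro continuous_intros)
    fix x assume x: "x \<in> S"
    have "1 \<le> norm (f y $ i - f x $ i)" if y: "y \<in> S" "f y $ i \<noteq> f x $ i" for y
      using Ints_nonzero_abs_ge1[of "f y $ i - f x $ i"] assms(3) x y by auto
    then show "\<exists>e>0. \<forall>y. y \<in> S \<and> f y $ i \<noteq> f x $ i \<longrightarrow> e \<le> norm (f y $ i - f x $ i)"
      by (intro exI[of _ 1]) auto
  qed
  then obtain c where "\<And>i x. x \<in> S \<Longrightarrow> f x $ i = c i" unfolding constant_on_def by metis
  then show ?thesis unfolding constant_on_def by (intro exI[of _ "\<chi> i. c i"]) (simp add: vec_eq_iff)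
qed

lemma lifts_differ_by_constant:
  fixes F F' :: "'a::topological_space \<Rightarrow> real^2"
  assumes "connected S" "continuous_on S F" "continuous_on S F'"
    and "\<And>x. x \<in> S \<Longrightarrow> torus_proj (F x) = torus_proj (F' x)"
  obtains w where "\<And>x. x \<in> S \<Longrightarrow> F x = F' x + w"
proof -
  have "(\<lambda>x. F x - F' x) constant_on S"
  proof (rule continuous_integer_vector_constant[OF assms(1)])
    show "continuous_on S (\<lambda>x. F x - F' x)" using assms(2,3) by (intro continuous_intros)
    show "(F x - F' x) $ i \<in> \<int>" if "x \<in> S" for x i
      using assms(4)[OF that] unfolding torus_proj_eq_iff by blast
  qed
  then obtain w where "\<And>x. x \<in> S \<Longrightarrow> F x - F' x = w" unfolding constant_on_def by blast
  then show thesis by (intro that[of w]) (auto simp: algebra_simps)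
qed

text \<open>\<open>acts_linearly B \<psi>\<close> says that \<open>\<psi>\<close> induces the matrix \<open>B\<close> on \<open>\<int>\<^sup>2\<close>, the fundamental group.\<close>

definition acts_linearly :: "real^2^2 \<Rightarrow> (torus \<Rightarrow> torus) \<Rightarrow> bool" where
  "acts_linearly B \<psi> \<longleftrightarrow>
     (\<exists>F. is_lift F \<psi> \<and> (\<forall>x v. (\<forall>i. v $ i \<in> \<int>) \<longrightarrow> F (x + v) = F x + B *v v))"

lemma is_lift_unique:
  assumes "is_lift F \<psi>" "is_lift F' \<psi>"
  obtains w where "\<And>x. F x = F' x + w"
  using assms lifts_differ_by_constant[of UNIV F F'] unfolding is_lift_def by auto

text \<open>Two lifts differ by a constant, so equivariance of one lift passes to every
  other.\<close>

lemma acts_linearlyD: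
  assumes "acts_linearly B \<psi>" "is_lift F \<psi>" "\<forall>i. v $ i \<in> \<int>"
  shows "F (x + v) = F x + B *v v"
proof -
  obtain F' where F': "is_lift F' \<psi>" "F' (x + v) = F' x + B *v v" for x
    using assms unfolding acts_linearly_def by blast
  obtain w where "\<And>x. F x = F' x + w" using is_lift_unique[OF assms(2) F'(1)] by blast
  then show ?thesis by (simp add: F'(2))
qed

lemma is_lift_compose: "is_lift F \<phi> \<Longrightarrow> is_lift F' \<psi> \<Longrightarrow> is_lift (F \<circ> F') (\<phi> \<circ> \<psi>)"
  unfolding is_lift_def by (auto intro!: continuous_on_compose intro: continuous_on_subset simp del: o_apply) simp

lemma integer_matrix_vector:
  assumes "\<forall>i. v $ i \<in> \<int>"
  shows "\<forall>i. (map_matrix real_of_int A *v v) $ i \<in> \<int>"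
  using assms by (auto simp: matrix_vector_mult_def intro!: Ints_sum Ints_mult)

text \<open>The inner matrix is integral because equivariance of the outer lift is only available
  for integer vectors.\<close>

lemma acts_linearly_compose:
  assumes "acts_linearly B \<phi>" "acts_linearly (map_matrix real_of_int A) \<psi>"
  shows "acts_linearly (B ** map_matrix real_of_int A) (\<phi> \<circ> \<psi>)"
proof -
  obtain F F' where F: "is_lift F \<phi>" "is_lift F' \<psi>"
    using assms unfolding acts_linearly_def by blast
  have "(F \<circ> F') (x + v) = (F \<circ> F') x + (B ** map_matrix real_of_int A) *v v"
    if "\<forall>i. v $ i \<in> \<int>" for x v
    using acts_linearlyD[OF assms(2) F(2) that]
      acts_linearlyD[OF assms(1) F(1) integer_matrix_vector[OF that]]
    by (simp add: matrix_vector_mul_assoc)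
  then show ?thesis using is_lift_compose[OF F] unfolding acts_linearly_def by blast
qed

lemma acts_linearly_unique:
  assumes "acts_linearly B \<psi>" "acts_linearly B' \<psi>"
  shows "B = B'"
proof -
  obtain F where F: "is_lift F \<psi>" using assms unfolding acts_linearly_def by blast
  have "B *v axis i 1 = B' *v axis i 1" for i
  proof -
    have "\<forall>j. axis i (1::real) $ j \<in> \<int>" by (simp add: axis_def)
    from acts_linearlyD[OF assms(1) F this, of 0] acts_linearlyD[OF assms(2) F this, of 0]
    show ?thesis by simp
  qed
  then show ?thesis by (simp add: matrix_vector_mult_basis column_def vec_eq_iff)
qed

lemma acts_linearly_id: "acts_linearly (mat 1) id"
  unfolding acts_linearly_def is_lift_def by (intro exI[of _ id]) (auto simp: continuous_on_id)

text \<open>The isotopy is lifted as a whole to \<open>{0..1} \<times> UNIV\<close>. Translating by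
  an integer vector \<open>v\<close> changes the lift by a constant \<open>u\<close> on this
  connected set. At time 1 the lift is linear up to a constant, so \<open>u\<close> is
  \<open>A\<close> applied to \<open>v\<close>, and this is read off at time 0.\<close>

lemma isotopic_acts_linearly:
  assumes "isotopic \<psi> (toral_aut A)"
  shows "acts_linearly (map_matrix real_of_int A) \<psi>"
proof -
  let ?A = "map_matrix real_of_int A"
  obtain h where h: "continuous_map (prod_topology (top_of_set {0..1::real}) (top_of_set UNIV)) (top_of_set UNIV) h"
      "\<And>x. h (0, x) = \<psi> x" "\<And>x. h (1, x) = toral_aut A x"
    using assms unfolding isotopic_def homotopic_with_def by auto
  have ch: "continuous_on ({0..1} \<times> UNIV) h"
    using h(1) unfolding prod_topology_subtopology_eu continuous_map_subtopology_eu by simp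
  define S where "S = {0..1::real} \<times> (UNIV :: (real^2) set)"
  have "convex S" by (simp add: S_def convex_Times)
  then have S: "contractible S" "connected S"
    by (simp_all add: convex_imp_contractible convex_connected)
  have "continuous_on S (\<lambda>z. (fst z, torus_proj (snd z)))"
    by (intro continuous_intros continuous_on_compose2[OF continuous_on_torus_proj]) auto
  then have "continuous_on S (\<lambda>z. h (fst z, torus_proj (snd z)))"
    by (rule continuous_on_compose2[OF ch]) (auto simp: S_def)
  then obtain F where F: "continuous_on S F" "\<And>z. z \<in> S \<Longrightarrow> torus_proj (F z) = h (fst z, torus_proj (snd z))"
    by (rule torus_lift_exists[OF _ S(1)]) blast
  have slice: "continuous_on UNIV (\<lambda>x. F (t, x))" if "t \<in> {0..1}" for t
    by (rule continuous_on_compose2[OF F(1)]) (use that in \<open>auto simp: S_def intro!: continuous_intros\<close>)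
  obtain w where "\<And>x. x \<in> UNIV \<Longrightarrow> F (1, x) = ?A *v x + w"
  proof (rule lifts_differ_by_constant)
    show "connected (UNIV :: (real^2) set)" by (rule convex_connected) simp
    show "continuous_on UNIV (\<lambda>x. F (1, x))" by (rule slice) simp
    show "continuous_on UNIV ((*v) ?A)" by (rule matrix_vector_mult_linear_continuous_on)
    show "torus_proj (F (1, x)) = torus_proj (?A *v x)" for x
      using F(2)[of "(1, x)"] by (simp add: S_def h(3) toral_aut.abs_eq)
  qed blast
  then have w: "F (1, x) = ?A *v x + w" for x by simp
  have "F (0, x + v) = F (0, x) + ?A *v v" if v: "\<forall>i. v $ i \<in> \<int>" for x v
  proof -
    obtain u where u: "\<And>z. z \<in> S \<Longrightarrow> F (fst z, snd z + v) = F z + u"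
    proof (rule lifts_differ_by_constant[OF S(2)])
      show "continuous_on S (\<lambda>z. F (fst z, snd z + v))"
        by (rule continuous_on_compose2[OF F(1)]) (auto simp: S_def intro!: continuous_intros)
      show "continuous_on S F" by (rule F)
      fix z assume "z \<in> S"
      moreover have "torus_proj (snd z + v) = torus_proj (snd z)"
        using v by (simp add: torus_proj_eq_iff)
      ultimately show "torus_proj (F (fst z, snd z + v)) = torus_proj (F z)"
        by (auto simp: F(2) S_def)
    qed blast
    have "u = ?A *v v"
      using u[of "(1, 0)"] w[of v] w[of 0] by (simp add: S_def)
    with u[of "(0, x)"] show ?thesis by (simp add: S_def)
  qed
  moreover have "is_lift (\<lambda>x. F (0, x)) \<psi>"
    unfolding is_lift_def using slice F(2)[of "(0, _)"] by (auto simp: S_def h(2))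
  ultimately show ?thesis unfolding acts_linearly_def by blast
qed

section \<open>Means on bounded Borel functions\<close>

text \<open>Bounded Borel functions rather than continuous ones, because the representing measure is
  built from the values of a mean on indicators of closed sets.\<close>

definition bounded_borel :: "('a::topological_space \<Rightarrow> real) set" where
  "bounded_borel = {f \<in> borel_measurable borel. bounded (range f)}"

text \<open>The value \<open>0\<close> is imposed outside the bounded Borel functions so that the means form a compact set.\<close>

definition means :: "(('a::topological_space \<Rightarrow> real) \<Rightarrow> real) set" where
  "means = {L. (\<forall>f. f \<notin> bounded_borel \<longrightarrow> L f = 0)
     \<and> (\<forall>f\<in>bounded_borel. \<forall>g\<in>bounded_borel. L (\<lambda>x. f x + g x) = L f + L g)
     \<and> (\<forall>f\<in>bounded_borel. \<forall>c. L (\<lambda>x. c * f x) = c * L f)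
     \<and> (\<forall>f\<in>bounded_borel. (\<forall>x. 0 \<le> f x) \<longrightarrow> 0 \<le> L f)
     \<and> L (\<lambda>_. 1) = 1}"

lemma bounded_borelI: "f \<in> borel_measurable borel \<Longrightarrow> (\<And>x. \<bar>f x\<bar> \<le> C) \<Longrightarrow> f \<in> bounded_borel"
  by (auto simp: bounded_borel_def bounded_iff)

lemma bounded_borelE:
  assumes "f \<in> bounded_borel"
  obtains C where "f \<in> borel_measurable borel" "0 < C" "\<And>x. \<bar>f x\<bar> \<le> C"
  using assms unfolding bounded_borel_def bounded_pos by auto

lemma bounded_borel_const: "(\<lambda>_. c) \<in> bounded_borel"
  by (rule bounded_borelI[of _ "\<bar>c\<bar>"]) auto

lemma bounded_borel_add:
  assumes "f \<in> bounded_borel" "g \<in> bounded_borel"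
  shows "(\<lambda>x. f x + g x) \<in> bounded_borel"
proof -
  obtain C where C: "f \<in> borel_measurable borel" "\<And>x. \<bar>f x\<bar> \<le> C" using assms(1) bounded_borelE by metis
  obtain D where D: "g \<in> borel_measurable borel" "\<And>x. \<bar>g x\<bar> \<le> D" using assms(2) bounded_borelE by metis
  have "\<bar>f x + g x\<bar> \<le> C + D" for x using C(2)[of x] D(2)[of x] by linarith
  then show ?thesis using C(1) D(1) by (intro bounded_borelI[of _ "C + D"]) auto
qed

lemma bounded_borel_cmult:
  assumes "f \<in> bounded_borel"
  shows "(\<lambda>x. c * f x) \<in> bounded_borel"
proof -
  obtain C where C: "f \<in> borel_measurable borel" "\<And>x. \<bar>f x\<bar> \<le> C" using assms(1) bounded_borelE by metis
  have "\<bar>c * f x\<bar> \<le> \<bar>c\<bar> * C" for x using C(2)[of x] by (simp add: abs_mult mult_left_mono)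
  then show ?thesis using C(1) by (intro bounded_borelI[of _ "\<bar>c\<bar> * C"]) auto
qed

lemma bounded_borel_diff:
  "f \<in> bounded_borel \<Longrightarrow> g \<in> bounded_borel \<Longrightarrow> (\<lambda>x. f x - g x) \<in> bounded_borel"
  using bounded_borel_add[of f "\<lambda>x. (-1) * g x"] bounded_borel_cmult[of g "-1"] by simp

lemma bounded_borel_sum:
  "(\<And>i. i \<in> I \<Longrightarrow> f i \<in> bounded_borel) \<Longrightarrow> (\<lambda>x. \<Sum>i\<in>I. f i x) \<in> bounded_borel"
  by (induction I rule: infinite_finite_induct) (auto intro: bounded_borel_add bounded_borel_const)

lemma bounded_borel_indicator: "A \<in> sets borel \<Longrightarrow> indicator A \<in> bounded_borel"
  by (rule bounded_borelI[of _ 1]) (auto simp: indicator_def)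

lemma bounded_borel_continuous:
  assumes "compact (UNIV :: 'a::topological_space set)" "continuous_on UNIV (f :: 'a \<Rightarrow> real)"
  shows "f \<in> bounded_borel"
  using compact_imp_bounded[OF compact_continuous_image[OF assms(2,1)]] assms(2)
  by (simp add: bounded_borel_def borel_measurable_continuous_onI)

lemma means_add:
  "L \<in> means \<Longrightarrow> f \<in> bounded_borel \<Longrightarrow> g \<in> bounded_borel \<Longrightarrow> L (\<lambda>x. f x + g x) = L f + L g"
  by (simp add: means_def)

lemma means_cmult: "L \<in> means \<Longrightarrow> f \<in> bounded_borel \<Longrightarrow> L (\<lambda>x. c * f x) = c * L f"
  by (simp add: means_def)

lemma means_nonneg: "L \<in> means \<Longrightarrow> f \<in> bounded_borel \<Longrightarrow> (\<And>x. 0 \<le> f x) \<Longrightarrow> 0 \<le> L f"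
  by (simp add: means_def)

lemma means_const: "L \<in> means \<Longrightarrow> L (\<lambda>_. c) = c"
  using means_cmult[of L "\<lambda>_. 1" c] by (simp add: bounded_borel_const means_def)

lemma means_diff:
  assumes "L \<in> means" "f \<in> bounded_borel" "g \<in> bounded_borel"
  shows "L (\<lambda>x. f x - g x) = L f - L g"
  using means_add[OF assms(1,2) bounded_borel_cmult[OF assms(3), of "-1"]] means_cmult[OF assms(1,3), of "-1"]
  by simp

lemma means_sum:
  assumes "L \<in> means" "\<And>i. i \<in> I \<Longrightarrow> f i \<in> bounded_borel"
  shows "L (\<lambda>x. \<Sum>i\<in>I. f i x) = (\<Sum>i\<in>I. L (f i))"
  using assms(2)
  by (induction I rule: infinite_finite_induct)
    (simp_all add: means_const[OF assms(1)] means_add[OF assms(1)] bounded_borel_sum)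

lemma means_mono:
  assumes "L \<in> means" "f \<in> bounded_borel" "g \<in> bounded_borel" "\<And>x. f x \<le> g x"
  shows "L f \<le> L g"
  using means_nonneg[OF assms(1) bounded_borel_diff[OF assms(3,2)]] means_diff[OF assms(1,3,2)] assms(4)
  by simp

lemma means_abs_le:
  assumes "L \<in> means" "f \<in> bounded_borel" "\<And>x. \<bar>f x\<bar> \<le> C"
  shows "\<bar>L f\<bar> \<le> C"
proof -
  have "L f \<le> L (\<lambda>_. C)" "L (\<lambda>_. - C) \<le> L f"
    by (rule means_mono[OF assms(1,2) bounded_borel_const], use assms(3) abs_le_iff in blast)
      (rule means_mono[OF assms(1) bounded_borel_const assms(2)], use assms(3) abs_le_iff minus_le_iff in metis)
  then show ?thesis using means_const[OF assms(1)] by (simp add: abs_le_iff minus_le_iff)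
qed

text \<open>A bound of \<open>f\<close> confines \<open>L f\<close> to an interval independent of
  \<open>L\<close>, so \<open>means\<close> lies in a product of compact intervals. Each defining
  condition compares evaluations at fixed functions and is therefore closed.\<close>

lemma compact_means: "compact (means :: (('a::topological_space \<Rightarrow> real) \<Rightarrow> real) set)"
proof -
  have "\<exists>C. \<forall>L\<in>means. \<bar>L f\<bar> \<le> C" for f :: "'a \<Rightarrow> real"
  proof (cases "f \<in> bounded_borel")
    case True
    then show ?thesis using means_abs_le bounded_borelE by metis
  qed (auto simp: means_def)
  then obtain C where C: "\<And>L f. L \<in> means \<Longrightarrow> \<bar>L f\<bar> \<le> C (f :: 'a \<Rightarrow> real)" by metis
  define P where "P = PiE UNIV (\<lambda>f. {- C f..C f})"
  have "compact P"
    using compactin_PiE[of "\<lambda>_. euclidean" UNIV "\<lambda>f. {- C f..C f}"]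
    by (simp add: P_def euclidean_product_topology)
  moreover have "means \<subseteq> P" using C unfolding P_def PiE_UNIV_domain by (auto simp: abs_le_iff) (metis abs_le_iff minus_le_iff)
  moreover have "closed (means :: (('a \<Rightarrow> real) \<Rightarrow> real) set)"
  proof -
    have cont: "continuous_on UNIV (\<lambda>L :: ('a \<Rightarrow> real) \<Rightarrow> real. L f)" for f
      by (rule continuous_on_product_coordinates)
    show ?thesis
      unfolding means_def Ball_def
      by (intro closed_Collect_conj closed_Collect_all closed_Collect_imp open_Collect_const
          closed_Collect_eq closed_Collect_le continuous_intros cont)
  qed
  ultimately show ?thesis
    using compact_Int_closed[of P means] by (simp add: Int_absorb1)
qed

lemma convex_means: "convex_functions means"
  unfolding convex_functions_def
proof (intro ballI)
  fix L L' :: "('a \<Rightarrow> real) \<Rightarrow> real" and t :: real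
  assume L: "L \<in> means" "L' \<in> means" and t: "t \<in> {0..1}"
  show "(\<lambda>x. (1 - t) * L x + t * L' x) \<in> means"
    unfolding means_def
  proof (intro CollectI conjI allI ballI impI)
    fix f :: "'a \<Rightarrow> real" assume f: "f \<in> bounded_borel"
    show "0 \<le> (1 - t) * L f + t * L' f" if "\<forall>x. 0 \<le> f x"
      using that t means_nonneg[OF L(1) f] means_nonneg[OF L(2) f] by simp
    show "(1 - t) * L (\<lambda>x. c * f x) + t * L' (\<lambda>x. c * f x) = c * ((1 - t) * L f + t * L' f)" for c
      by (simp add: means_cmult[OF L(1) f] means_cmult[OF L(2) f] algebra_simps)
    fix g :: "'a \<Rightarrow> real" assume g: "g \<in> bounded_borel"
    show "(1 - t) * L (\<lambda>x. f x + g x) + t * L' (\<lambda>x. f x + g x) =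
        (1 - t) * L f + t * L' f + ((1 - t) * L g + t * L' g)"
      by (simp add: means_add[OF L(1) f g] means_add[OF L(2) f g] algebra_simps)
  qed (use L in \<open>simp_all add: means_def\<close>)
qed

definition integral_mean :: "'a::topological_space measure \<Rightarrow> ('a \<Rightarrow> real) \<Rightarrow> real" where
  "integral_mean \<mu> f = (if f \<in> bounded_borel then integral\<^sup>L \<mu> f else 0)"

lemma integrable_bounded_borel:
  fixes \<mu> :: "'a::topological_space measure"
  assumes "prob_space \<mu>" and sets: "sets \<mu> = sets borel" and f: "f \<in> bounded_borel"
  shows "integrable \<mu> f"
proof -
  interpret prob_space \<mu> by fact
  obtain C where "f \<in> borel_measurable borel" "\<And>x. \<bar>f x\<bar> \<le> C" using f bounded_borelE by metis
  then show ?thesis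
    by (intro integrable_const_bound[of _ C]) (auto simp: measurable_cong_sets[OF sets refl])
qed

lemma integral_mean_in_means:
  fixes \<mu> :: "'a::topological_space measure"
  assumes P: "prob_space \<mu>" and S: "sets \<mu> = sets borel"
  shows "integral_mean \<mu> \<in> means"
proof -
  interpret prob_space \<mu> by fact
  show ?thesis
    using integrable_bounded_borel[OF P S]
    by (auto simp: means_def integral_mean_def bounded_borel_add bounded_borel_cmult bounded_borel_const prob_space)
qed

text \<open>\<open>L \<circ> pullback \<psi>\<close> is the push-forward of the mean
  \<open>L\<close> under \<open>\<psi>\<close>, so invariance of \<open>L\<close> reads
  \<open>L \<circ> pullback \<psi> = L\<close>.\<close>

definition pullback :: "('a \<Rightarrow> 'a) \<Rightarrow> ('a \<Rightarrow> real) \<Rightarrow> ('a \<Rightarrow> real)" where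
  "pullback \<psi> f = f \<circ> \<psi>"

lemma bounded_borel_pullback:
  assumes "continuous_on UNIV \<psi>" "f \<in> bounded_borel"
  shows "pullback \<psi> f \<in> bounded_borel"
proof -
  obtain C where C: "f \<in> borel_measurable borel" "\<And>x. \<bar>f x\<bar> \<le> C" using assms(2) bounded_borelE by metis
  have "\<psi> \<in> borel_measurable borel" using assms(1) by (rule borel_measurable_continuous_onI)
  with C show ?thesis
    by (intro bounded_borelI[of _ C]) (auto simp: pullback_def intro: measurable_comp)
qed

text \<open>Means vanish off the bounded Borel functions, so pulling back must not bring a function
  from outside into this class; the inverse homeomorphism excludes that.\<close>

lemma bounded_borel_pullback_iff:
  assumes "homeomorphism UNIV UNIV \<psi> \<psi>'"
  shows "pullback \<psi> f \<in> bounded_borel \<longleftrightarrow> f \<in> bounded_borel"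
proof
  assume "pullback \<psi> f \<in> bounded_borel"
  then have "pullback \<psi>' (pullback \<psi> f) \<in> bounded_borel"
    using assms by (intro bounded_borel_pullback[of \<psi>']) (simp_all add: homeomorphism_def)
  moreover have "pullback \<psi>' (pullback \<psi> f) = f"
    using assms by (auto simp: pullback_def homeomorphism_def fun_eq_iff)
  ultimately show "f \<in> bounded_borel" by simp
next
  show "f \<in> bounded_borel \<Longrightarrow> pullback \<psi> f \<in> bounded_borel"
    using assms by (intro bounded_borel_pullback) (auto simp: homeomorphism_def)
qed

lemma means_pullback:
  assumes "homeomorphism UNIV UNIV \<psi> \<psi>'" "L \<in> means"
  shows "L \<circ> pullback \<psi> \<in> means"
proof -
  note bb = bounded_borel_pullback_iff[OF assms(1)]
  have bb': "f \<in> bounded_borel \<Longrightarrow> (\<lambda>x. f (\<psi> x)) \<in> bounded_borel" for f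
    using bb[of f] by (simp add: pullback_def comp_def)
  show ?thesis
    unfolding means_def
  proof (intro CollectI conjI allI ballI impI)
    show "f \<notin> bounded_borel \<Longrightarrow> (L \<circ> pullback \<psi>) f = 0" for f
      using bb assms(2) by (simp add: means_def)
    show "f \<in> bounded_borel \<Longrightarrow> g \<in> bounded_borel \<Longrightarrow> (L \<circ> pullback \<psi>) (\<lambda>x. f x + g x) =
        (L \<circ> pullback \<psi>) f + (L \<circ> pullback \<psi>) g" for f g
      using means_add[OF assms(2) bb' bb', of f g] by (simp add: pullback_def comp_def)
    show "f \<in> bounded_borel \<Longrightarrow> (L \<circ> pullback \<psi>) (\<lambda>x. c * f x) = c * (L \<circ> pullback \<psi>) f" for f c
      using means_cmult[OF assms(2) bb', of f c] by (simp add: pullback_def comp_def)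
    show "f \<in> bounded_borel \<Longrightarrow> \<forall>x. 0 \<le> f x \<Longrightarrow> 0 \<le> (L \<circ> pullback \<psi>) f" for f
      using means_nonneg[OF assms(2) bb', of f] by (simp add: pullback_def comp_def)
    show "(L \<circ> pullback \<psi>) (\<lambda>_. 1) = 1"
      using means_const[OF assms(2), of 1] by (simp add: pullback_def comp_def)
  qed
qed

section \<open>Representation of means by measures\<close>

locale compact_mean =
  fixes L :: "('a::metric_space \<Rightarrow> real) \<Rightarrow> real"
  assumes mean: "L \<in> means" and compact_space: "compact (UNIV :: 'a set)"
begin

text \<open>A mean is only finitely additive, and its value on an open set need not be the supremum
  of its values on closed subsets. Taking this supremum instead restores countable subadditivity on
  open sets.\<close>

definition inner_content :: "'a set \<Rightarrow> ennreal" where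
  "inner_content U = (SUP C\<in>{C. closed C \<and> C \<subseteq> U}. ennreal (L (indicator C)))"

definition outer_content :: "'a set \<Rightarrow> ennreal" where
  "outer_content A = (INF U\<in>{U. open U \<and> A \<subseteq> U}. inner_content U)"

lemma L_indicator_nonneg: "A \<in> sets borel \<Longrightarrow> 0 \<le> L (indicator A)"
  by (rule means_nonneg[OF mean bounded_borel_indicator]) auto

lemma L_indicator_mono:
  "A \<in> sets borel \<Longrightarrow> B \<in> sets borel \<Longrightarrow> A \<subseteq> B \<Longrightarrow> L (indicator A) \<le> L (indicator B)"
  by (rule means_mono[OF mean bounded_borel_indicator bounded_borel_indicator]) (auto simp: indicator_def)

lemma L_indicator_le_1: "A \<in> sets borel \<Longrightarrow> L (indicator A) \<le> 1"
  using means_abs_le[OF mean bounded_borel_indicator, of A 1] by (auto simp: indicator_def)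

lemma inner_upper: "closed C \<Longrightarrow> C \<subseteq> U \<Longrightarrow> ennreal (L (indicator C)) \<le> inner_content U"
  unfolding inner_content_def by (rule SUP_upper) auto

lemma inner_mono: "U \<subseteq> V \<Longrightarrow> inner_content U \<le> inner_content V"
  unfolding inner_content_def by (rule SUP_subset_mono) auto

lemma inner_le_L: "U \<in> sets borel \<Longrightarrow> inner_content U \<le> ennreal (L (indicator U))"
  unfolding inner_content_def by (rule SUP_least) (auto intro!: ennreal_leI L_indicator_mono)

lemma inner_le_1: "inner_content U \<le> 1"
  unfolding inner_content_def by (rule SUP_least) (auto intro!: L_indicator_le_1)

text \<open>A closed \<open>C\<close> inside the union is compact, hence covered by finitely many
  balls whose closed versions each lie in a single \<open>U j\<close>. Those with the same index
  \<open>j\<close> form a closed subset \<open>D j\<close> of \<open>U j\<close>, and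
  \<open>L\<close> is finitely subadditive on the \<open>D j\<close>.\<close>

lemma inner_countably_subadditive:
  fixes U :: "nat \<Rightarrow> 'a set"
  assumes U: "\<And>i. open (U i)"
  shows "inner_content (\<Union>i. U i) \<le> (\<Sum>i. inner_content (U i))"
proof -
  have "ennreal (L (indicator C)) \<le> (\<Sum>i. inner_content (U i))" if C: "closed C" "C \<subseteq> (\<Union>i. U i)" for C
  proof -
    have "compact C" using compact_Int_closed[OF compact_space C(1)] by simp
    have "\<exists>i e. 0 < e \<and> cball p e \<subseteq> U i" if "p \<in> C" for p
    proof -
      obtain i where "p \<in> U i" using C(2) \<open>p \<in> C\<close> by blast
      then show ?thesis using U[of i] open_contains_cball by blast
    qed
    then obtain i e where ie: "\<And>p. p \<in> C \<Longrightarrow> 0 < e p" "\<And>p. p \<in> C \<Longrightarrow> cball p (e p) \<subseteq> U (i p)"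
      by metis
    have "C \<subseteq> (\<Union>p\<in>C. ball p (e p))" using ie(1) by (auto intro: centre_in_ball[THEN iffD2])
    then obtain T where T: "T \<subseteq> C" "finite T" "C \<subseteq> (\<Union>p\<in>T. ball p (e p))"
      using compactE_image[OF \<open>compact C\<close>, of C "\<lambda>p. ball p (e p)"] by auto
    define D where "D j = (\<Union>p\<in>{p\<in>T. i p = j}. cball p (e p))" for j
    have D: "closed (D j)" "D j \<subseteq> U j" for j
      using T ie(2) by (auto simp: D_def)
    have bb: "indicator (D j) \<in> bounded_borel" for j
      using D(1) by (intro bounded_borel_indicator) auto
    have "indicator C x \<le> (\<Sum>j\<in>i ` T. indicator (D j) x :: real)" for x
    proof (cases "x \<in> C")
      case True
      then obtain p where p: "p \<in> T" "x \<in> ball p (e p)" using T(3) by auto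
      then have "x \<in> D (i p)" by (auto simp: D_def)
      then have "(indicator C x :: real) \<le> indicator (D (i p)) x" by (simp add: indicator_def)
      also have "\<dots> \<le> (\<Sum>j\<in>i ` T. indicator (D j) x)"
        using p T(2) by (intro member_le_sum) auto
      finally show ?thesis .
    qed (simp add: sum_nonneg)
    then have "L (indicator C) \<le> L (\<lambda>x. \<Sum>j\<in>i ` T. indicator (D j) x)"
      using C(1) bb by (intro means_mono[OF mean] bounded_borel_indicator[of C] bounded_borel_sum) auto
    also have "\<dots> = (\<Sum>j\<in>i ` T. L (indicator (D j)))"
      using bb by (intro means_sum[OF mean])
    finally have "ennreal (L (indicator C)) \<le> (\<Sum>j\<in>i ` T. ennreal (L (indicator (D j))))"
      using D(1) by (subst sum_ennreal) (auto intro!: ennreal_leI L_indicator_nonneg)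
    also have "\<dots> \<le> (\<Sum>j\<in>i ` T. inner_content (U j))"
      using D by (intro sum_mono inner_upper)
    also have "\<dots> \<le> (\<Sum>j. inner_content (U j))"
      using T(2) by (intro sum_le_suminf) auto
    finally show ?thesis .
  qed
  then show ?thesis unfolding inner_content_def[of "\<Union>i. U i"] by (intro SUP_least) auto
qed

lemma outer_le_inner: "open U \<Longrightarrow> A \<subseteq> U \<Longrightarrow> outer_content A \<le> inner_content U"
  unfolding outer_content_def by (rule INF_lower) auto

lemma outer_open: "open U \<Longrightarrow> outer_content U = inner_content U"
  by (rule antisym[OF outer_le_inner]) (auto simp: outer_content_def intro!: INF_greatest inner_mono)

lemma outer_mono: "A \<subseteq> B \<Longrightarrow> outer_content A \<le> outer_content B"
  unfolding outer_content_def by (rule INF_superset_mono) auto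

lemma outer_measure_space_outer: "outer_measure_space (Pow UNIV) outer_content"
  unfolding outer_measure_space_def
proof (intro conjI)
  have "inner_content {} = 0"
    using inner_le_L[of "{}"] means_const[OF mean, of 0] by (simp add: indicator_def[abs_def])
  then show "positive (Pow UNIV) outer_content" by (simp add: positive_def outer_open)
  show "increasing (Pow UNIV) outer_content" by (auto simp: increasing_def intro: outer_mono)
  have "outer_content (\<Union>i. A i) \<le> (\<Sum>i. outer_content (A i))" for A :: "nat \<Rightarrow> 'a set"
  proof (rule ennreal_le_epsilon)
    fix e :: real assume "0 < e"
    have "\<exists>U. open U \<and> A i \<subseteq> U \<and> inner_content U < outer_content (A i) + ennreal (e * (1/2) ^ Suc i)" for i
    proof -
      \<comment> \<open>Finiteness makes the added slack a strict increase, so an open superset with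
        content below it exists.\<close>
      have "outer_content (A i) \<le> 1"
        using outer_le_inner[of UNIV "A i"] inner_le_1[of UNIV] by (auto intro: order_trans)
      then have fin: "outer_content (A i) < \<infinity>" by (rule le_less_trans) simp
      have "0 < ennreal (e * (1/2) ^ Suc i)" using \<open>0 < e\<close> by simp
      then have "outer_content (A i) < outer_content (A i) + ennreal (e * (1/2) ^ Suc i)"
        using fin by (simp add: ennreal_add_left_cancel_less[of _ 0, simplified])
      then show ?thesis unfolding outer_content_def[of "A i"] INF_less_iff by auto
    qed
    then obtain U where U: "\<And>i. open (U i)" "\<And>i. A i \<subseteq> U i"
        "\<And>i. inner_content (U i) < outer_content (A i) + ennreal (e * (1/2) ^ Suc i)"
      by metis
    have "outer_content (\<Union>i. A i) \<le> inner_content (\<Union>i. U i)"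
      using U by (intro outer_le_inner) auto
    also have "\<dots> \<le> (\<Sum>i. inner_content (U i))" by (rule inner_countably_subadditive) (rule U)
    also have "\<dots> \<le> (\<Sum>i. outer_content (A i) + ennreal (e * (1/2) ^ Suc i))"
      by (intro suminf_le less_imp_le U) auto
    also have "\<dots> = (\<Sum>i. outer_content (A i)) + (\<Sum>i. ennreal (e * (1/2) ^ Suc i))"
      by (subst suminf_add[symmetric]) (auto simp del: power_Suc)
    also have "(\<Sum>i. ennreal (e * (1/2) ^ Suc i)) = ennreal e"
      using \<open>0 < e\<close> sums_mult[OF power_half_series, of e] by (intro suminf_ennreal_eq) auto
    finally show "outer_content (\<Union>i. A i) \<le> (\<Sum>i. outer_content (A i)) + ennreal e" .
  qed
  then show "countably_subadditive (Pow UNIV) outer_content" by (simp add: countably_subadditive_def)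
qed

text \<open>If \<open>C\<close> is a closed subset of \<open>A \<inter> V\<close>, any closed subset
  of \<open>V - C\<close> is disjoint from \<open>C\<close>, and \<open>L\<close> is additive on the
  two. Suprema give the claim, as \<open>V - C\<close> is an open superset of
  \<open>V - A\<close>.\<close>

lemma inner_split:
  assumes "open A" "open V"
  shows "inner_content (A \<inter> V) + outer_content (V - A) \<le> inner_content V"
proof -
  have "ennreal (L (indicator C)) + inner_content (V - C) \<le> inner_content V" if C: "closed C" "C \<subseteq> A \<inter> V" for C
  proof -
    have "ennreal (L (indicator C)) + ennreal (L (indicator D)) \<le> inner_content V" if D: "closed D" "D \<subseteq> V - C" for D
    proof -
      have "L (indicator (C \<union> D)) = L (\<lambda>x. indicator C x + indicator D x)"
        using D by (intro arg_cong[where f = L] ext) (auto simp: indicator_def)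
      also have "\<dots> = L (indicator C) + L (indicator D)"
        using C D by (intro means_add[OF mean] bounded_borel_indicator) auto
      finally have "ennreal (L (indicator C)) + ennreal (L (indicator D)) = ennreal (L (indicator (C \<union> D)))"
        using C D by (simp add: L_indicator_nonneg)
      also have "\<dots> \<le> inner_content V" using C D by (intro inner_upper) auto
      finally show ?thesis .
    qed
    then show ?thesis
      unfolding inner_content_def[of "V - C"]
      by (subst ennreal_SUP_add_right) (auto intro!: SUP_least)
  qed
  moreover have "outer_content (V - A) \<le> inner_content (V - C)" if "closed C" "C \<subseteq> A \<inter> V" for C
    using that assms by (intro outer_le_inner) auto
  ultimately have "ennreal (L (indicator C)) + outer_content (V - A) \<le> inner_content V" if "closed C" "C \<subseteq> A \<inter> V" for C
    using that by (meson add_left_mono order_trans)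
  then show ?thesis
    unfolding inner_content_def[of "A \<inter> V"]
    by (subst ennreal_SUP_add_left[symmetric]) (auto intro!: SUP_least)
qed

lemma open_in_lambda_system:
  assumes "open A"
  shows "A \<in> lambda_system UNIV (Pow UNIV) outer_content"
proof -
  have "outer_content (X \<inter> A) + outer_content (X - A) = outer_content X" for X
  proof (rule antisym)
    have "outer_content (X \<inter> A) + outer_content (X - A) \<le> inner_content V" if "open V" "X \<subseteq> V" for V
    proof -
      have "outer_content (X \<inter> A) + outer_content (X - A) \<le> inner_content (A \<inter> V) + outer_content (V - A)"
        using that assms by (intro add_mono outer_le_inner outer_mono) auto
      then show ?thesis using inner_split[OF assms \<open>open V\<close>] by (rule order_trans)
    qed
    then show "outer_content (X \<inter> A) + outer_content (X - A) \<le> outer_content X"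
      unfolding outer_content_def[of X] by (auto intro!: INF_greatest)
    interpret algebra UNIV "Pow UNIV :: 'a set set" by (rule algebra_Pow)
    have "subadditive (Pow UNIV) outer_content"
      using outer_measure_space_outer countably_subadditive_subadditive[of outer_content]
      unfolding outer_measure_space_def by blast
    from subadditiveD[OF this, of "X \<inter> A" "X - A"]
    show "outer_content X \<le> outer_content (X \<inter> A) + outer_content (X - A)" by (auto simp: Int_Diff_Un)
  qed
  then show ?thesis
    unfolding algebra.lambda_system_eq[OF algebra_Pow] by blast
qed

definition repr :: "'a measure" where
  "repr = measure_of UNIV (sets borel) outer_content"

lemma sets_repr [measurable_cong]: "sets repr = sets borel"
  unfolding repr_def using sets.sets_measure_of_eq[of "borel :: 'a measure" outer_content] by simp

lemma space_repr [simp]: "space repr = UNIV"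
  by (simp add: repr_def space_measure_of_conv)

text \<open>The Caratheodory measurable sets form a sigma-algebra containing the open sets, hence
  all Borel sets, and \<open>outer_content\<close> is restricted to the latter.\<close>

lemma emeasure_repr: "A \<in> sets borel \<Longrightarrow> emeasure repr A = outer_content A"
proof -
  let ?S = "lambda_system UNIV (Pow UNIV) outer_content"
  have ms: "measure_space UNIV ?S outer_content"
    by (rule sigma_algebra.caratheodory_lemma[OF sigma_algebra_Pow outer_measure_space_outer])
  then have "sigma_algebra UNIV ?S" by (simp add: measure_space_def)
  then have "sets (borel :: 'a measure) \<subseteq> ?S"
    unfolding borel_def sets_measure_of[OF subset_UNIV[of "{S. open S}", unfolded Pow_UNIV[symmetric]]]
    by (rule sigma_algebra.sigma_sets_subset) (use open_in_lambda_system in blast)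
  then have "measure_space UNIV (sets borel) outer_content"
    by (rule measure_down[OF ms, rotated]) (use sets.sigma_algebra_axioms[of borel] in simp)
  then show "A \<in> sets borel \<Longrightarrow> emeasure repr A = outer_content A"
    unfolding repr_def
    by (intro emeasure_measure_of_sigma) (auto simp: measure_space_def)
qed

lemma prob_space_repr: "prob_space repr"
proof
  have "ennreal (L (indicator UNIV)) \<le> inner_content UNIV" by (rule inner_upper) auto
  moreover have "L (indicator UNIV) = 1"
    using means_const[OF mean, of 1] by (simp add: indicator_def)
  ultimately have "inner_content UNIV = 1" using inner_le_1[of UNIV] by auto
  then show "emeasure repr (space repr) = 1" by (simp add: emeasure_repr outer_open)
qed

lemma measure_repr_open: "open U \<Longrightarrow> measure repr U \<le> L (indicator U)"
  using inner_le_L[of U] L_indicator_nonneg[of U]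
  by (auto simp: measure_def emeasure_repr outer_open intro!: enn2real_leI)

text \<open>A layer-cake argument: \<open>s\<close> counts the levels \<open>i / n\<close> exceeded
  by \<open>f\<close> and so lies between \<open>n * f\<close> and \<open>n * f + 1\<close>. Its
  level sets are open, and on open sets the measure is at most \<open>L\<close>; the resulting error
  is \<open>1 / n\<close>.\<close>

lemma integral_repr_le:
  fixes f :: "'a \<Rightarrow> real"
  assumes f: "continuous_on UNIV f" "\<And>x. 0 \<le> f x" "\<And>x. f x \<le> 1"
  shows "integral\<^sup>L repr f \<le> L f"
proof (rule field_le_epsilon)
  fix e :: real assume "0 < e"
  then obtain n :: nat where n: "n > 0" "1 / n < e"
    by (metis real_arch_inverse inverse_eq_divide of_nat_0_less_iff neq0_conv)
  note bb = bounded_borel_continuous[OF compact_space f(1)]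
  define U where "U i = {x. real i < real n * f x}" for i
  have opU: "open (U i)" for i
    unfolding U_def using f(1) by (intro open_Collect_less continuous_intros)
  have bbU: "indicator (U i) \<in> bounded_borel" for i
    using opU by (intro bounded_borel_indicator) auto
  define s :: "'a \<Rightarrow> real" where "s x = (\<Sum>i<n. indicator (U i) x)" for x
  have s: "n * f x \<le> s x" "s x \<le> n * f x + 1" for x
  proof -
    define y where "y = n * f x"
    have y: "0 \<le> y" "y \<le> n" using f(2,3)[of x] n(1) by (auto simp: y_def mult_left_le)
    \<comment> \<open>Exactly \<open>nat \<lceil>y\<rceil>\<close> natural numbers are less than
      \<open>y\<close>, and all of them are less than \<open>n\<close> because
      \<open>y \<le> n\<close>.\<close>
    have "s x = card {i. i < n \<and> real i < y}"
      by (simp add: s_def U_def y_def indicator_def sum.If_cases Int_def)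
    also have "{i. i < n \<and> real i < y} = {..<nat \<lceil>y\<rceil>}"
      using y by (auto simp: less_ceiling_iff zless_nat_eq_int_zless)
    finally have "s x = nat \<lceil>y\<rceil>" by simp
    then show "n * f x \<le> s x" "s x \<le> n * f x + 1"
      using y unfolding y_def[symmetric] by linarith+
  qed
  interpret prob_space repr by (rule prob_space_repr)
  note int = integrable_bounded_borel[OF prob_space_repr sets_repr]
  have bbs: "s \<in> bounded_borel" unfolding s_def using bbU by (intro bounded_borel_sum)
  have "n * integral\<^sup>L repr f = (\<integral>x. n * f x \<partial>repr)" by simp
  also have "\<dots> \<le> integral\<^sup>L repr s"
    using s(1) by (intro integral_mono int bounded_borel_cmult bb bbs)
  also have "\<dots> = (\<Sum>i<n. measure repr (U i))"
    unfolding s_def using int[OF bbU] opU by (subst Bochner_Integration.integral_sum) auto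
  also have "\<dots> \<le> (\<Sum>i<n. L (indicator (U i)))"
    by (intro sum_mono measure_repr_open opU)
  also have "\<dots> = L s" unfolding s_def using bbU by (intro means_sum[OF mean, symmetric])
  also have "\<dots> \<le> L (\<lambda>x. n * f x + 1)"
    using s(2) by (intro means_mono[OF mean] bbs bounded_borel_add bounded_borel_cmult bb bounded_borel_const)
  also have "\<dots> = n * L f + 1"
    by (simp add: means_add[OF mean bounded_borel_cmult[OF bb] bounded_borel_const] means_cmult[OF mean bb] means_const[OF mean])
  finally have "integral\<^sup>L repr f \<le> L f + 1 / n" using n(1) by (simp add: field_simps)
  then show "integral\<^sup>L repr f \<le> L f + e" using n(2) by simp
qed

text \<open>Applying the one-sided estimate to \<open>1 - g\<close> as well gives equality when
  \<open>g\<close> takes values between 0 and 1, and every continuous \<open>f\<close> is an affine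
  image of such a \<open>g\<close>.\<close>

theorem integral_repr:
  fixes f :: "'a \<Rightarrow> real"
  assumes f: "continuous_on UNIV f"
  shows "integral\<^sup>L repr f = L f"
proof -
  interpret prob_space repr by (rule prob_space_repr)
  have bb: "g \<in> bounded_borel" if "continuous_on UNIV g" for g :: "'a \<Rightarrow> real"
    using bounded_borel_continuous[OF compact_space that] .
  have int: "integrable repr g" if "continuous_on UNIV g" for g :: "'a \<Rightarrow> real"
    using integrable_bounded_borel[OF prob_space_repr sets_repr bb[OF that]] .
  have eq: "integral\<^sup>L repr g = L g" if g: "continuous_on UNIV g" "\<And>x. 0 \<le> g x" "\<And>x. g x \<le> 1" for g
  proof (rule antisym)
    show "integral\<^sup>L repr g \<le> L g" by (rule integral_repr_le[OF g])
    have "continuous_on UNIV (\<lambda>x. 1 - g x)" using g(1) by (intro continuous_intros)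
    from integral_repr_le[OF this] have "(\<integral>x. 1 - g x \<partial>repr) \<le> L (\<lambda>x. 1 - g x)" using g by simp
    then show "L g \<le> integral\<^sup>L repr g"
      using int[OF g(1)]
      using prob_space by (simp add: means_diff[OF mean bounded_borel_const bb[OF g(1)]] means_const[OF mean])
  qed
  obtain C where C: "0 < C" "\<And>x. \<bar>f x\<bar> \<le> C" using bb[OF f] bounded_borelE by metis
  define g where "g x = 1 / (2 * C) * f x + 1/2" for x
  have g: "continuous_on UNIV g" unfolding g_def using f by (intro continuous_intros)
  have fe: "f = (\<lambda>x. (2 * C) * g x + (- C))" using C(1) by (auto simp: g_def algebra_simps)
  have "0 \<le> g x" "g x \<le> 1" for x
    using C(1) C(2)[of x] by (auto simp: g_def field_simps abs_le_iff)
  then have "integral\<^sup>L repr g = L g" by (intro eq g)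
  then show ?thesis
    unfolding fe using int[OF g]
    by (subst means_add[OF mean bounded_borel_cmult[OF bb[OF g]] bounded_borel_const])
      (simp add: means_cmult[OF mean bb[OF g]] means_const[OF mean] prob_space[simplified])
qed

text \<open>\<open>\<psi>\<close> and its inverse permute the closed sets, so an open set and its
  preimage have the same inner content. The open sets form an intersection-stable generator of the
  Borel sets.\<close>

lemma repr_invariant:
  assumes hom: "homeomorphism UNIV UNIV \<psi> \<psi>'" and inv: "L \<circ> pullback \<psi> = L"
  shows "distr repr borel \<psi> = repr"
proof -
  have cont: "continuous_on UNIV \<psi>" "continuous_on UNIV \<psi>'"
    and id: "\<And>x. \<psi>' (\<psi> x) = x" "\<And>x. \<psi> (\<psi>' x) = x"
    using hom by (auto simp: homeomorphism_def)
  have closed_vimage: "closed (h -` C)" if "continuous_on UNIV h" "closed C" for h :: "'a \<Rightarrow> 'a" and C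
    using that by (simp add: continuous_on_closed_vimage)
  have L_vimage: "L (indicator (\<psi> -` C)) = L (indicator C)" for C
  proof -
    have "pullback \<psi> (indicator C) = (indicator (\<psi> -` C) :: 'a \<Rightarrow> real)"
      by (auto simp: pullback_def indicator_def)
    with inv show ?thesis by (metis comp_apply)
  qed
  have "inner_content (\<psi> -` U) = inner_content U" for U
  proof (rule antisym)
    show "inner_content U \<le> inner_content (\<psi> -` U)"
      unfolding inner_content_def[of U]
    proof (rule SUP_least)
      fix C assume "C \<in> {C. closed C \<and> C \<subseteq> U}"
      then show "ennreal (L (indicator C)) \<le> inner_content (\<psi> -` U)"
        using inner_upper[of "\<psi> -` C" "\<psi> -` U"] closed_vimage[OF cont(1), of C] L_vimage[of C] by auto
    qed
    show "inner_content (\<psi> -` U) \<le> inner_content U"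
      unfolding inner_content_def[of "\<psi> -` U"]
    proof (rule SUP_least)
      fix C assume C: "C \<in> {C. closed C \<and> C \<subseteq> \<psi> -` U}"
      have "\<psi> -` (\<psi>' -` C) = C" by (auto simp: id)
      moreover have "\<psi>' -` C \<subseteq> U" using C id(2) by (force simp: subset_eq)
      ultimately show "ennreal (L (indicator C)) \<le> inner_content U"
        using inner_upper[of "\<psi>' -` C" U] closed_vimage[OF cont(2), of C] C L_vimage[of "\<psi>' -` C"] by auto
    qed
  qed
  then have em: "emeasure repr (\<psi> -` U) = emeasure repr U" if "open U" for U
    using that open_vimage[OF that cont(1)] by (simp add: emeasure_repr outer_open)
  have meas: "\<psi> \<in> measurable repr borel"
    using borel_measurable_continuous_onI[OF cont(1)] by (simp add: measurable_cong_sets[OF sets_repr refl])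
  interpret prob_space repr by (rule prob_space_repr)
  show ?thesis
  proof (rule measure_eqI_generator_eq[where E = "{U. open U}" and \<Omega> = UNIV and A = "\<lambda>_. UNIV"])
    show "Int_stable {U :: 'a set. open U}" by (auto simp: Int_stable_def)
    show "sets (distr repr borel \<psi>) = sigma_sets UNIV {U. open U}" by (simp add: borel_def)
    show "sets repr = sigma_sets UNIV {U. open U}" by (simp add: sets_repr) (simp add: borel_def)
    show "emeasure (distr repr borel \<psi>) X = emeasure repr X" if "X \<in> {U. open U}" for X
      using that em meas by (simp add: emeasure_distr)
    show "emeasure (distr repr borel \<psi>) UNIV \<noteq> \<infinity>" for i :: nat
      using meas by (simp add: emeasure_distr)
  qed auto
qed

end

section \<open>Rotation vectors of means\<close>

definition mean_vector :: "((torus \<Rightarrow> real) \<Rightarrow> real) \<Rightarrow> (torus \<Rightarrow> real^2) \<Rightarrow> real^2" where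
  "mean_vector L g = (\<chi> i. L (\<lambda>p. g p $ i))"

lemma bounded_borel_component:
  "continuous_on UNIV g \<Longrightarrow> (\<lambda>p. g p $ i) \<in> bounded_borel" for g :: "torus \<Rightarrow> real^2"
  by (rule bounded_borel_continuous[OF compact_torus]) (intro continuous_intros)

lemma mean_vector_add:
  assumes "L \<in> means" "continuous_on UNIV g" "continuous_on UNIV h"
  shows "mean_vector L (\<lambda>p. g p + h p) = mean_vector L g + mean_vector L h"
  using means_add[OF assms(1) bounded_borel_component[OF assms(2)] bounded_borel_component[OF assms(3)]]
  by (simp add: mean_vector_def vec_eq_iff)

lemma mean_vector_diff:
  assumes "L \<in> means" "continuous_on UNIV g" "continuous_on UNIV h"
  shows "mean_vector L (\<lambda>p. g p - h p) = mean_vector L g - mean_vector L h"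
  using means_diff[OF assms(1) bounded_borel_component[OF assms(2)] bounded_borel_component[OF assms(3)]]
  by (simp add: mean_vector_def vec_eq_iff)

lemma mean_vector_const: "L \<in> means \<Longrightarrow> mean_vector L (\<lambda>_. c) = c"
  by (simp add: mean_vector_def means_const vec_eq_iff)

lemma mean_vector_matrix:
  assumes "L \<in> means" "continuous_on UNIV g"
  shows "mean_vector L (\<lambda>p. B *v g p) = B *v mean_vector L g"
proof -
  note bb = bounded_borel_component[OF assms(2)]
  have "L (\<lambda>p. \<Sum>j\<in>UNIV. B $ i $ j * g p $ j) = (\<Sum>j\<in>UNIV. B $ i $ j * L (\<lambda>p. g p $ j))" for i
    by (subst means_sum[OF assms(1) bounded_borel_cmult[OF bb]]) (simp add: means_cmult[OF assms(1) bb])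
  then show ?thesis by (simp add: mean_vector_def vec_eq_iff matrix_vector_mult_def)
qed

lemma mean_vector_comp_pullback:
  "mean_vector (L \<circ> pullback \<psi>) g = mean_vector L (\<lambda>p. g (\<psi> p))"
  by (simp add: mean_vector_def pullback_def comp_def)

lemma mean_vector_invariant:
  "L \<circ> pullback \<psi> = L \<Longrightarrow> mean_vector L (\<lambda>p. g (\<psi> p)) = mean_vector L g"
  using mean_vector_comp_pullback[of L \<psi> g] by simp

definition mean_rotation :: "((torus \<Rightarrow> real) \<Rightarrow> real) \<Rightarrow> (real^2 \<Rightarrow> real^2) \<Rightarrow> real^2" where
  "mean_rotation L F = mean_vector L (displacement F)"

lemma is_lift_continuous_on:
  "is_lift F \<psi> \<Longrightarrow> continuous_on UNIV F"
  by (simp add: is_lift_def)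

lemma is_lift_proj: "is_lift F \<psi> \<Longrightarrow> \<psi> (torus_proj x) = torus_proj (F x)"
  by (simp add: is_lift_def)

lemma is_lift_continuous:
  assumes "is_lift F \<psi>"
  shows "continuous_on UNIV \<psi>"
proof (rule continuous_on_torusI)
  have "continuous_on UNIV (\<lambda>x. torus_proj (F x))"
    by (rule continuous_on_compose2[OF continuous_on_torus_proj is_lift_continuous_on[OF assms]]) simp
  then show "continuous_on UNIV (\<lambda>x. \<psi> (torus_proj x))"
    by (simp add: is_lift_proj[OF assms])
qed

lemma displacement_proj:
  assumes "acts_linearly (mat 1) \<phi>" "is_lift F \<phi>"
  shows "displacement F (torus_proj x) = F x - x"
  by (rule displacement_torus_proj) (use acts_linearlyD[OF assms] in simp)

lemma continuous_displacement:
  assumes "acts_linearly (mat 1) \<phi>" "is_lift F \<phi>"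
  shows "continuous_on UNIV (displacement F)"
proof (rule continuous_on_torusI)
  have "continuous_on UNIV (\<lambda>x. F x - x)"
    using is_lift_continuous_on[OF assms(2)] by (intro continuous_intros)
  then show "continuous_on UNIV (\<lambda>x. displacement F (torus_proj x))"
    by (simp add: displacement_proj[OF assms])
qed

text \<open>The bound depends on \<open>F\<close> and not on the mean, so it controls rotation
  vectors along whole orbits of means.\<close>

lemma mean_rotation_bounded:
  assumes "acts_linearly (mat 1) \<phi>" "is_lift F \<phi>"
  obtains C where "\<And>L. L \<in> means \<Longrightarrow> norm (mean_rotation L F) \<le> C"
proof -
  note bb = bounded_borel_component[OF continuous_displacement[OF assms]]
  have "\<exists>c. \<forall>L\<in>means. \<bar>L (\<lambda>p. displacement F p $ i)\<bar> \<le> c" for i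
    using means_abs_le[OF _ bb[of i]] bounded_borelE[OF bb[of i]] by metis
  then obtain c where c: "\<And>L i. L \<in> means \<Longrightarrow> \<bar>L (\<lambda>p. displacement F p $ i)\<bar> \<le> c i" by metis
  have "norm (mean_rotation L F) \<le> (\<Sum>i\<in>UNIV. c i)" if "L \<in> means" for L
    using c[OF that]
    by (intro order_trans[OF norm_le_l1_cart] sum_mono) (simp add: mean_rotation_def mean_vector_def)
  then show thesis by (rule that)
qed

text \<open>The lifts of the identity are translations. This is the start of the induction over
  commutators.\<close>

lemma mean_rotation_identity:
  assumes "is_lift E id"
  obtains w where "\<And>L. L \<in> means \<Longrightarrow> mean_rotation L E = w"
proof -
  have "is_lift (\<lambda>x. x) id" by (simp add: is_lift_def)
  then obtain w where "\<And>x. E x = x + w" using is_lift_unique[OF assms] by metis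
  then have "displacement E = (\<lambda>_. w)" by (simp add: displacement_def fun_eq_iff)
  then show thesis by (intro that[of w]) (simp add: mean_rotation_def mean_vector_const)
qed

text \<open>The displacement of \<open>E\<close> at \<open>\<psi> p\<close> is rewritten through \<open>\<Psi> \<circ> E \<circ> E'\<close>, which lifts the same map as
  \<open>E \<circ> \<Psi>\<close>; the non-linear part of \<open>\<Psi>\<close> contributes a coboundary only.\<close>

lemma mean_rotation_pullback:
  assumes comm: "e \<circ> \<psi> = \<psi> \<circ> e \<circ> e'"
    and act: "acts_linearly B \<psi>" "acts_linearly (mat 1) e" "acts_linearly (mat 1) e'"
    and lift: "is_lift E e" "is_lift E' e'"
  obtains w where "\<And>L. L \<in> means \<Longrightarrow> L \<circ> pullback e = L \<Longrightarrow> L \<circ> pullback e' = L \<Longrightarrow>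
    mean_rotation (L \<circ> pullback \<psi>) E = B *v (mean_rotation L E + mean_rotation L E') + w"
proof -
  obtain \<Psi> where \<Psi>: "is_lift \<Psi> \<psi>" using act(1) by (auto simp: acts_linearly_def)
  have "is_lift (E \<circ> \<Psi>) (e \<circ> \<psi>)" by (rule is_lift_compose[OF lift(1) \<Psi>])
  moreover have "is_lift (\<Psi> \<circ> E \<circ> E') (e \<circ> \<psi>)"
    unfolding comm by (intro is_lift_compose \<Psi> lift)
  ultimately obtain w where "\<And>x. (E \<circ> \<Psi>) x = (\<Psi> \<circ> E \<circ> E') x + w"
    by (rule is_lift_unique) blast
  then have w: "E (\<Psi> x) = \<Psi> (E (E' x)) + w" for x by simp
  \<comment> \<open>\<open>b\<close> is the periodic part of \<open>\<Psi>\<close>: by equivariance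
    it does not depend on the representative, so it is a continuous function on the torus.\<close>
  define b where "b p = \<Psi> (rep_torus p) - B *v rep_torus p" for p
  have b: "b (torus_proj x) = \<Psi> x - B *v x" for x
  proof -
    have "\<forall>i. (rep_torus (torus_proj x) - x) $ i \<in> \<int>"
      using torus_proj_rep[of "torus_proj x"] unfolding torus_proj_eq_iff .
    from acts_linearlyD[OF act(1) \<Psi> this, of x] show ?thesis
      by (simp add: b_def matrix_vector_mult_diff_distrib)
  qed
  have cb: "continuous_on UNIV b"
  proof (rule continuous_on_torusI)
    show "continuous_on UNIV (\<lambda>x. b (torus_proj x))"
      unfolding b using is_lift_continuous_on[OF \<Psi>]
      by (intro continuous_intros matrix_vector_mult_linear_continuous_on)
  qed
  note dE = displacement_proj[OF act(2) lift(1)] and dE' = displacement_proj[OF act(3) lift(2)]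
  note cE = continuous_displacement[OF act(2) lift(1)] and cE' = continuous_displacement[OF act(3) lift(2)]
  have ce: "continuous_on UNIV e" "continuous_on UNIV e'" by (rule is_lift_continuous lift)+
  have disp: "displacement E (\<psi> p) =
      b (e (e' p)) - b p + B *v (displacement E' p + displacement E (e' p)) + w" for p
  proof -
    obtain x where p: "p = torus_proj x" using surj_torus_proj by blast
    have "displacement E (\<psi> p) = E (\<Psi> x) - \<Psi> x"
      by (simp add: p is_lift_proj[OF \<Psi>] dE)
    also have "\<dots> = b (e (e' p)) + B *v E (E' x) - (b p + B *v x) + w"
      by (simp add: p is_lift_proj[OF lift(1)] is_lift_proj[OF lift(2)] b w)
    also have "B *v E (E' x) = B *v x + B *v (displacement E' p + displacement E (e' p))"
      by (simp add: p is_lift_proj[OF lift(2)] dE dE' flip: matrix_vector_right_distrib)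
    finally show ?thesis by simp
  qed
  have comp: "continuous_on UNIV (\<lambda>p. h (k p))"
    if "continuous_on UNIV h" "continuous_on UNIV k" for h :: "torus \<Rightarrow> 'c::topological_space" and k :: "torus \<Rightarrow> torus"
    using that by (rule continuous_on_compose2) simp
  show thesis
  proof
    fix L assume L: "L \<in> means" and inv: "L \<circ> pullback e = L" "L \<circ> pullback e' = L"
    have c1: "continuous_on UNIV (\<lambda>p. b (e (e' p)))"
      using comp[OF comp[OF cb ce(1)] ce(2)] .
    have c2: "continuous_on UNIV (\<lambda>p. displacement E (e' p))" using comp[OF cE ce(2)] .
    have c3: "continuous_on UNIV (\<lambda>p. displacement E' p + displacement E (e' p))"
      by (intro continuous_intros cE' c2)
    have c4: "continuous_on UNIV (\<lambda>p. B *v (displacement E' p + displacement E (e' p)))"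
      by (rule continuous_on_compose2[of UNIV "(*v) B", OF matrix_vector_mult_linear_continuous_on c3]) simp
    have "mean_rotation (L \<circ> pullback \<psi>) E = mean_vector L (\<lambda>p. displacement E (\<psi> p))"
      by (simp add: mean_rotation_def mean_vector_comp_pullback)
    also have "\<dots> = mean_vector L (\<lambda>p. b (e (e' p))) - mean_vector L b
        + B *v (mean_vector L (displacement E') + mean_vector L (\<lambda>p. displacement E (e' p))) + w"
      unfolding disp
      using L c1 c2 c3 c4 cb cE'
      by (simp add: mean_vector_add mean_vector_diff mean_vector_matrix mean_vector_const continuous_on_add continuous_on_diff)
    \<comment> \<open>Invariance of \<open>L\<close> under \<open>e'\<close> and then under
      \<open>e\<close> removes the coboundary.\<close>
    also have "mean_vector L (\<lambda>p. b (e (e' p))) = mean_vector L b"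
      using mean_vector_invariant[OF inv(2), of "\<lambda>p. b (e p)"] mean_vector_invariant[OF inv(1), of b] by simp
    also have "mean_vector L (\<lambda>p. displacement E (e' p)) = mean_vector L (displacement E)"
      by (rule mean_vector_invariant[OF inv(2)])
    finally show "mean_rotation (L \<circ> pullback \<psi>) E = B *v (mean_rotation L E + mean_rotation L E') + w"
      unfolding mean_rotation_def by (simp only: diff_self add_0_left add.commute)
  qed
qed

section \<open>Bounded orbits under unipotent and hyperbolic matrices\<close>

lemma bounded_arithmetic_sequence:
  fixes x :: "nat \<Rightarrow> 'a::real_normed_vector"
  assumes "\<And>k. x (Suc k) = x k + c" "\<And>k. norm (x k) \<le> C"
  shows "c = 0"
proof (rule ccontr)
  assume "c \<noteq> 0"
  have x: "x k = x 0 + of_nat k *\<^sub>R c" for k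
    by (induction k) (simp_all add: assms(1) algebra_simps)
  obtain k :: nat where "2 * C < real k * norm c"
    using reals_Archimedean3[of "norm c"] \<open>c \<noteq> 0\<close> by auto
  also have "\<dots> = norm (x k - x 0)" using x[of k] by simp
  also have "\<dots> \<le> 2 * C" using norm_triangle_ineq4[of "x k" "x 0"] assms(2)[of k] assms(2)[of 0] by linarith
  finally show False by simp
qed

text \<open>For \<open>N = B - mat 1\<close> the increments satisfy
  \<open>d (Suc k) = d k + N *v d k\<close>, and \<open>N *v d k\<close> is constant because
  \<open>N\<close> has square zero. So \<open>d\<close> is a bounded arithmetic progression, hence
  constant; then \<open>a\<close> is one too.\<close>

lemma bounded_unipotent_orbit_constant:
  fixes a :: "nat \<Rightarrow> real^'n"
  assumes rec: "\<And>k. a (Suc k) = B *v a k + c" and bdd: "\<And>k. norm (a k) \<le> C"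
    and unip: "(B - mat 1) ** (B - mat 1) = 0"
  shows "a (Suc 0) = a 0"
proof -
  define N where "N = B - mat 1"
  define d where "d k = a (Suc k) - a k" for k
  have d: "d k = N *v a k + c" for k
    by (simp add: d_def N_def rec matrix_vector_mult_diff_rdistrib)
  have Nd: "d (Suc k) = d k + N *v d k" for k
  proof -
    have "d (Suc k) = N *v (a k + d k) + c" using d[of "Suc k"] by (simp add: d_def)
    also have "\<dots> = (N *v a k + c) + N *v d k" by (simp add: matrix_vector_right_distrib)
    finally show ?thesis using d[of k] by simp
  qed
  have NN: "N *v (N *v x) = 0" for x
    using unip by (simp add: N_def matrix_vector_mul_assoc)
  have const: "N *v d k = N *v d 0" for k
    by (induction k) (simp_all add: Nd matrix_vector_right_distrib NN)
  have step: "d (Suc k) = d k + N *v d 0" for k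
    using Nd[of k] unfolding const[of k] .
  have "norm (d k) \<le> C + C" for k
    unfolding d_def by (rule order_trans[OF norm_triangle_ineq4 add_mono[OF bdd bdd]])
  then have "N *v d 0 = 0"
    using bounded_arithmetic_sequence[of d "N *v d 0", OF step] by blast
  then have dk: "d k = d 0" for k
    by (induction k) (simp_all add: step)
  have "a (Suc k) = a k + d 0" for k
    using d_def[of k] unfolding dk[of k] by (simp add: algebra_simps)
  then have "d 0 = 0"
    using bounded_arithmetic_sequence[of a "d 0" C] bdd by blast
  then show ?thesis by (simp add: d_def)
qed

text \<open>Cayley--Hamilton for \<open>B\<^sup>2\<close>.\<close>

lemma cayley_hamilton_square:
  fixes B :: "real^2^2" and t :: real
  assumes "det B * det B = 1" "t = (B$1$1 + B$2$2)^2 - 2 * det B"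
  shows "B *v (B *v (B *v (B *v v))) + v = t *\<^sub>R (B *v (B *v v))"
proof -
  define a b c d x y where "a = B$1$1" "b = B$1$2" "c = B$2$1" "d = B$2$2" "x = v$1" "y = v$2"
  note defs = this
  have D: "(a*d - b*c) * (a*d - b*c) = 1" and t: "t = (a + d)^2 - 2 * (a*d - b*c)"
    using assms by (simp_all add: det_2 defs)
  show ?thesis
    unfolding vec_eq_iff forall_2
    apply (simp add: matrix_vector_mult_def sum_2 flip: defs)
    unfolding t using D by algebra
qed

text \<open>The quantity bounded below by 3 is the trace \<open>t\<close> of the square of
  \<open>B\<close>, whose determinant is 1 for either sign of \<open>det B\<close>. By
  Cayley-Hamilton, \<open>t *\<^sub>R d\<close> is the sum of two elements of
  \<open>\<Delta>\<close>: the image of \<open>d\<close> under this square and a preimage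
  \<open>v\<close>. So the supremum \<open>s\<close> of the norms satisfies
  \<open>3 * s \<le> 2 * s\<close>.\<close>

lemma hyperbolic_bounded_invariant_zero:
  fixes B :: "real^2^2"
  assumes det: "det B * det B = 1" and tr: "\<bar>(B$1$1 + B$2$2)^2 - 2 * det B\<bar> \<ge> 3"
    and bdd: "\<And>d. d \<in> \<Delta> \<Longrightarrow> norm d \<le> C"
    and fwd: "\<And>d. d \<in> \<Delta> \<Longrightarrow> B *v d \<in> \<Delta>" and bwd: "\<And>d. d \<in> \<Delta> \<Longrightarrow> \<exists>d'\<in>\<Delta>. d = B *v d'"
    and "d \<in> \<Delta>"
  shows "d = 0"
proof -
  define s where "s = Sup (norm ` \<Delta>)"
  have bd: "bdd_above (norm ` \<Delta>)" using bdd by (intro bdd_aboveI[of _ C]) auto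
  then have le: "norm d \<le> s" if "d \<in> \<Delta>" for d
    unfolding s_def using that by (intro cSup_upper) auto
  have "norm d \<le> 2 / 3 * s" if d: "d \<in> \<Delta>" for d
  proof -
    obtain v where v: "v \<in> \<Delta>" "d = B *v (B *v v)" using bwd[OF d] bwd by metis
    define t where "t = (B$1$1 + B$2$2)^2 - 2 * det B"
    have "3 * norm d \<le> \<bar>t\<bar> * norm d" using tr by (intro mult_right_mono) (auto simp: t_def)
    also have "\<dots> = norm (B *v (B *v d) + v)"
      using cayley_hamilton_square[OF det t_def, of v] by (simp add: v(2))
    also have "\<dots> \<le> s + s"
      using le[OF fwd[OF fwd[OF d]]] le[OF v(1)] by (intro order_trans[OF norm_triangle_ineq]) simp
    finally show ?thesis by simp
  qed
  then have "s \<le> 2 / 3 * s"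
    unfolding s_def using \<open>d \<in> \<Delta>\<close> by (intro cSup_least) auto
  with le[OF \<open>d \<in> \<Delta>\<close>] have "norm d \<le> 0" by linarith
  then show ?thesis by simp
qed

section \<open>Nilpotent groups of torus homeomorphisms\<close>

context group
begin

lemma lower_central_series_subgroup:
  assumes "subgroup H G"
  shows "subgroup (lower_central_series G H n) G"
proof (induction n)
  case (Suc n)
  have "x \<in> carrier G" if "x \<in> H" for x using assms that subgroup.mem_carrier by metis
  moreover have "y \<in> carrier G" if "y \<in> lower_central_series G H n" for y
    using Suc that subgroup.mem_carrier by metis
  ultimately show ?case
    unfolding lower_central_series.simps by (intro generate_is_subgroup) auto
qed (simp add: assms)

lemma lower_central_series_commutator:
  "x \<in> H \<Longrightarrow> y \<in> lower_central_series G H n \<Longrightarrow>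
    x \<otimes> y \<otimes> inv x \<otimes> inv y \<in> lower_central_series G H (Suc n)"
  unfolding lower_central_series.simps by (rule generate.incl) auto

lemma lower_central_series_decreasing:
  assumes "subgroup H G"
  shows "lower_central_series G H (Suc n) \<subseteq> lower_central_series G H n"
proof (induction n)
  case 0
  show ?case
    unfolding lower_central_series.simps
    by (rule generate_subgroup_incl[OF _ assms])
      (auto intro!: subgroup.m_closed[OF assms] subgroup.m_inv_closed[OF assms])
next
  case (Suc n)
  have "generate G (\<Union>x\<in>H. \<Union>y\<in>lower_central_series G H (Suc n). {x \<otimes> y \<otimes> inv x \<otimes> inv y})
      \<subseteq> generate G (\<Union>x\<in>H. \<Union>y\<in>lower_central_series G H n. {x \<otimes> y \<otimes> inv x \<otimes> inv y})"
    by (intro mono_generate UN_mono Suc subset_refl)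
  then show ?case by (simp only: lower_central_series.simps)
qed

lemma lower_central_series_antimono:
  assumes "subgroup H G" "m \<le> n"
  shows "lower_central_series G H n \<subseteq> lower_central_series G H m"
  using assms(2) lower_central_series_decreasing[OF assms(1)]
  by (induction n rule: dec_induct) auto

end

section \<open>Means invariant under sets of torus homeomorphisms\<close>

interpretation Homeo: group Homeo by (rule group_Homeo)

lemma Homeo_simps [simp]: "x \<otimes>\<^bsub>Homeo\<^esub> y = x \<circ> y" "\<one>\<^bsub>Homeo\<^esub> = id"
  by (simp_all add: Homeo_def)

lemma Homeo_inverse:
  assumes "x \<in> carrier Homeo"
  shows "homeomorphism UNIV UNIV x (inv\<^bsub>Homeo\<^esub> x)"
    and "x \<circ> inv\<^bsub>Homeo\<^esub> x = id" "inv\<^bsub>Homeo\<^esub> x \<circ> x = id"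
proof -
  show i: "x \<circ> inv\<^bsub>Homeo\<^esub> x = id" "inv\<^bsub>Homeo\<^esub> x \<circ> x = id"
    using Homeo.r_inv[OF assms] Homeo.l_inv[OF assms] by simp_all
  obtain g where g: "homeomorphism UNIV UNIV x g" using assms by (auto simp: Homeo_def)
  have "inv\<^bsub>Homeo\<^esub> x = g"
  proof
    fix p
    have "x (g p) = p" using g by (simp add: homeomorphism_def)
    then show "(inv\<^bsub>Homeo\<^esub> x) p = g p" using i(2) by (metis comp_apply id_apply)
  qed
  with g show "homeomorphism UNIV UNIV x (inv\<^bsub>Homeo\<^esub> x)" by simp
qed

lemma means_pullback_Homeo: "x \<in> carrier Homeo \<Longrightarrow> L \<in> means \<Longrightarrow> L \<circ> pullback x \<in> means"
  by (rule means_pullback[OF Homeo_inverse(1)])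

lemma pullback_comp: "pullback \<psi> \<circ> pullback \<phi> = pullback (\<phi> \<circ> \<psi>)"
  by (rule ext) (simp add: pullback_def comp_assoc)

lemma pullback_id: "L \<circ> pullback id = L"
  by (auto simp: pullback_def)

definition invariant_means :: "(torus \<Rightarrow> torus) set \<Rightarrow> ((torus \<Rightarrow> real) \<Rightarrow> real) set" where
  "invariant_means S = {L \<in> means. \<forall>s\<in>S. L \<circ> pullback s = L}"

text \<open>Prescribing the rotation vector prescribes the values of \<open>L\<close> at the two
  components of \<open>displacement F\<close>, which is a closed and affine condition on
  \<open>L\<close>.\<close>

lemma compact_invariant_means: "compact {L \<in> invariant_means S. mean_rotation L F = v}"
proof -
  have eq: "{L \<in> invariant_means S. mean_rotation L F = v} = means \<inter> (\<Inter>s\<in>S. {L. L \<circ> pullback s = L})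
      \<inter> (\<Inter>i. {L. L (\<lambda>p. displacement F p $ i) = v $ i})"
    by (auto simp: invariant_means_def mean_rotation_def mean_vector_def vec_eq_iff)
  show ?thesis
    unfolding eq
    by (intro compact_Int_closed compact_means closed_INT ballI closed_fixed_functions closed_eq_eval(2))
qed

lemma convex_invariant_means: "convex_functions {L \<in> invariant_means S. mean_rotation L F = v}"
  unfolding convex_functions_def
proof (intro ballI)
  fix L L' and t :: real
  assume L: "L \<in> {L \<in> invariant_means S. mean_rotation L F = v}"
    "L' \<in> {L \<in> invariant_means S. mean_rotation L F = v}" and t: "t \<in> {0..1}"
  define M where "M = (\<lambda>f. (1 - t) * L f + t * L' f)"
  have "M \<in> means"
    using convex_means L t unfolding convex_functions_def M_def invariant_means_def by blast
  moreover have "M \<circ> pullback s = M" if "s \<in> S" for s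
  proof
    fix f
    have "L (pullback s f) = L f" "L' (pullback s f) = L' f"
      using L that by (auto simp: invariant_means_def dest!: bspec[of S _ s] dest: fun_cong[of _ _ f])
    then show "(M \<circ> pullback s) f = M f" by (simp add: M_def)
  qed
  moreover have "mean_rotation M F = v"
    using L by (auto simp: M_def mean_rotation_def mean_vector_def vec_eq_iff algebra_simps)
  ultimately show "(\<lambda>f. (1 - t) * L f + t * L' f) \<in> {L \<in> invariant_means S. mean_rotation L F = v}"
    by (simp add: invariant_means_def M_def)
qed

lemma map_matrix_mult_of_int:
  "map_matrix real_of_int (A ** B) = map_matrix real_of_int A ** map_matrix real_of_int B" for A B :: "int^2^2"
  by (simp add: vec_eq_iff matrix_matrix_mult_def)

lemma map_matrix_mat_1: "map_matrix real_of_int (mat 1 :: int^2^2) = mat 1"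
  by (simp add: vec_eq_iff mat_def)

locale nilpotent_torus_group =
  fixes G :: "(torus \<Rightarrow> torus) set" and N :: nat and \<C> :: "(int^2^2) set"
  assumes subgroup_G: "subgroup G Homeo"
    and nilpotent: "lower_central_series Homeo G N = {id}"
    and class_ex: "\<And>g. g \<in> G \<Longrightarrow> \<exists>B\<in>\<C>. acts_linearly (map_matrix real_of_int B) g"
    and classes_commute: "\<And>A B. A \<in> \<C> \<Longrightarrow> B \<in> \<C> \<Longrightarrow> A ** B = B ** A"
begin

abbreviation \<Gamma> :: "nat \<Rightarrow> (torus \<Rightarrow> torus) set" where
  "\<Gamma> n \<equiv> lower_central_series Homeo G n"

lemmas subgroup_\<Gamma> = Homeo.lower_central_series_subgroup[OF subgroup_G]
lemmas \<Gamma>_antimono = Homeo.lower_central_series_antimono[OF subgroup_G]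

lemma \<Gamma>_subset_G: "\<Gamma> n \<subseteq> G"
  using \<Gamma>_antimono[of 0 n] by simp

lemma in_Homeo: "x \<in> G \<Longrightarrow> x \<in> carrier Homeo"
  using subgroup_G subgroup.mem_carrier by metis

lemma class_inverse:
  assumes "x \<in> G" "acts_linearly B x"
  obtains C where "C \<in> \<C>" "acts_linearly (map_matrix real_of_int C) (inv\<^bsub>Homeo\<^esub> x)"
    "B ** map_matrix real_of_int C = mat 1"
proof -
  have "inv\<^bsub>Homeo\<^esub> x \<in> G" using subgroup.m_inv_closed[OF subgroup_G assms(1)] .
  then obtain C where C: "C \<in> \<C>" "acts_linearly (map_matrix real_of_int C) (inv\<^bsub>Homeo\<^esub> x)"
    using class_ex by blast
  have "acts_linearly (B ** map_matrix real_of_int C) id"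
    using acts_linearly_compose[OF assms(2) C(2)] Homeo_inverse(2)[OF in_Homeo[OF assms(1)]] by simp
  then have "B ** map_matrix real_of_int C = mat 1" by (rule acts_linearly_unique[OF _ acts_linearly_id])
  with C show thesis by (rule that)
qed

lemma commutator_acts_trivially:
  assumes "x \<in> G" "y \<in> G"
  shows "acts_linearly (mat 1) (x \<circ> y \<circ> inv\<^bsub>Homeo\<^esub> x \<circ> inv\<^bsub>Homeo\<^esub> y)"
proof -
  let ?r = "map_matrix real_of_int :: int^2^2 \<Rightarrow> _"
  obtain A where A: "A \<in> \<C>" "acts_linearly (?r A) x" using class_ex[OF assms(1)] by blast
  obtain B where B: "B \<in> \<C>" "acts_linearly (?r B) y" using class_ex[OF assms(2)] by blast
  obtain A' where A': "A' \<in> \<C>" "acts_linearly (?r A') (inv\<^bsub>Homeo\<^esub> x)" "?r A ** ?r A' = mat 1"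
    using class_inverse[OF assms(1) A(2)] by blast
  obtain B' where B': "B' \<in> \<C>" "acts_linearly (?r B') (inv\<^bsub>Homeo\<^esub> y)" "?r B ** ?r B' = mat 1"
    using class_inverse[OF assms(2) B(2)] by blast
  have "?r A ** ?r B ** ?r A' ** ?r B' = ?r B ** (?r A ** ?r A') ** ?r B'"
    using classes_commute[OF A(1) B(1)] by (simp add: matrix_mul_assoc flip: map_matrix_mult_of_int)
  also have "\<dots> = mat 1" by (simp add: A'(3) B'(3))
  finally show ?thesis
    using acts_linearly_compose[OF acts_linearly_compose[OF acts_linearly_compose[OF A(2) B(2)] A'(2)] B'(2)]
    by simp
qed

lemma \<Gamma>_acts_trivially:
  assumes "e \<in> \<Gamma> (Suc n)"
  shows "acts_linearly (mat 1) e"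
proof -
  \<comment> \<open>Membership in \<open>G\<close> is recorded too, because inverses of generators
    are handled by \<open>class_inverse\<close>.\<close>
  have comm: "h \<in> G \<and> acts_linearly (mat 1) h"
    if h: "h \<in> (\<Union>x\<in>G. \<Union>y\<in>G. {x \<otimes>\<^bsub>Homeo\<^esub> y \<otimes>\<^bsub>Homeo\<^esub> inv\<^bsub>Homeo\<^esub> x \<otimes>\<^bsub>Homeo\<^esub> inv\<^bsub>Homeo\<^esub> y})" for h
  proof -
    obtain x y where xy: "x \<in> G" "y \<in> G" "h = x \<otimes>\<^bsub>Homeo\<^esub> y \<otimes>\<^bsub>Homeo\<^esub> inv\<^bsub>Homeo\<^esub> x \<otimes>\<^bsub>Homeo\<^esub> inv\<^bsub>Homeo\<^esub> y"
      using h by blast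
    have "h \<in> G"
      unfolding xy(3) using xy(1,2) by (intro subgroup.m_closed[OF subgroup_G] subgroup.m_inv_closed[OF subgroup_G])
    with commutator_acts_trivially[OF xy(1,2)] show ?thesis by (simp add: xy(3))
  qed
  have "e \<in> \<Gamma> 1" using assms \<Gamma>_antimono[of 1 "Suc n"] by auto
  then have "e \<in> generate Homeo (\<Union>x\<in>G. \<Union>y\<in>G. {x \<otimes>\<^bsub>Homeo\<^esub> y \<otimes>\<^bsub>Homeo\<^esub> inv\<^bsub>Homeo\<^esub> x \<otimes>\<^bsub>Homeo\<^esub> inv\<^bsub>Homeo\<^esub> y})"
    by (simp only: One_nat_def lower_central_series.simps)
  then show ?thesis
  proof (induction rule: generate.induct)
    case one
    show ?case unfolding Homeo_simps by (rule acts_linearly_id)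
  next
    case (incl h)
    then show ?case using comm by blast
  next
    case (inv h)
    with comm have h: "h \<in> G" "acts_linearly (mat 1) h" by blast+
    obtain C where "acts_linearly (map_matrix real_of_int C) (inv\<^bsub>Homeo\<^esub> h)" "mat 1 ** map_matrix real_of_int C = mat 1"
      using class_inverse[OF h] by blast
    then show ?case by simp
  next
    case (eng h1 h2)
    then have "acts_linearly (mat 1) (h1 \<circ> h2)"
      using acts_linearly_compose[of "mat 1" h1 "mat 1" h2] by (simp only: map_matrix_mat_1 matrix_mul_lid)
    then show ?case unfolding Homeo_simps .
  qed
qed

text \<open>Among the conventions for commutators, this one places the correction to the right of
  \<open>\<psi> \<circ> e\<close>; after the contravariant \<open>pullback\<close> it is then the
  first factor to meet a mean.\<close>

definition com :: "(torus \<Rightarrow> torus) \<Rightarrow> (torus \<Rightarrow> torus) \<Rightarrow> (torus \<Rightarrow> torus)" where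
  "com e \<psi> = inv\<^bsub>Homeo\<^esub> e \<circ> inv\<^bsub>Homeo\<^esub> \<psi> \<circ> e \<circ> \<psi>"

lemma com_eq:
  assumes "e \<in> G" "\<psi> \<in> G"
  shows "e \<circ> \<psi> = \<psi> \<circ> e \<circ> com e \<psi>"
  using Homeo_inverse(2)[OF in_Homeo[OF assms(1)]] Homeo_inverse(2)[OF in_Homeo[OF assms(2)]]
  by (simp add: com_def fun_eq_iff)

lemma com_in_\<Gamma>_right:
  assumes "e \<in> G" "\<psi> \<in> \<Gamma> j"
  shows "com e \<psi> \<in> \<Gamma> (Suc j)"
proof -
  have "inv\<^bsub>Homeo\<^esub> e \<in> G" by (rule subgroup.m_inv_closed[OF subgroup_G assms(1)])
  moreover have "inv\<^bsub>Homeo\<^esub> \<psi> \<in> \<Gamma> j" by (rule subgroup.m_inv_closed[OF subgroup_\<Gamma> assms(2)])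
  moreover have "\<psi> \<in> G" using assms(2) \<Gamma>_subset_G by blast
  ultimately show ?thesis
    using Homeo.lower_central_series_commutator[of "inv\<^bsub>Homeo\<^esub> e" G "inv\<^bsub>Homeo\<^esub> \<psi>" j] assms in_Homeo
    by (simp add: com_def Homeo.inv_inv)
qed

text \<open>In the lower central series the element of \<open>G\<close> comes first in a commutator,
  so \<open>com e \<psi>\<close> is obtained as the inverse of the commutator of the inverses of
  \<open>\<psi>\<close> and \<open>e\<close>.\<close>

lemma com_in_\<Gamma>_left:
  assumes "e \<in> \<Gamma> i" "\<psi> \<in> G"
  shows "com e \<psi> \<in> \<Gamma> (Suc i)"
proof -
  have eG: "e \<in> G" using assms(1) \<Gamma>_subset_G by blast
  have "inv\<^bsub>Homeo\<^esub> \<psi> \<in> G" by (rule subgroup.m_inv_closed[OF subgroup_G assms(2)])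
  moreover have "inv\<^bsub>Homeo\<^esub> e \<in> \<Gamma> i" by (rule subgroup.m_inv_closed[OF subgroup_\<Gamma> assms(1)])
  ultimately have "inv\<^bsub>Homeo\<^esub> \<psi> \<circ> inv\<^bsub>Homeo\<^esub> e \<circ> \<psi> \<circ> e \<in> \<Gamma> (Suc i)" (is "?c \<in> _")
    using Homeo.lower_central_series_commutator[of "inv\<^bsub>Homeo\<^esub> \<psi>" G "inv\<^bsub>Homeo\<^esub> e" i] eG assms in_Homeo
    by (simp add: Homeo.inv_inv)
  then have "inv\<^bsub>Homeo\<^esub> ?c \<in> \<Gamma> (Suc i)" by (rule subgroup.m_inv_closed[OF subgroup_\<Gamma>])
  moreover have "inv\<^bsub>Homeo\<^esub> ?c = com e \<psi>"
  proof (rule Homeo.inv_equality)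
    have id: "e \<circ> inv\<^bsub>Homeo\<^esub> e = id" "\<psi> \<circ> inv\<^bsub>Homeo\<^esub> \<psi> = id" "inv\<^bsub>Homeo\<^esub> e \<circ> e = id" "inv\<^bsub>Homeo\<^esub> \<psi> \<circ> \<psi> = id"
      using Homeo_inverse(2,3) in_Homeo eG assms(2) by blast+
    then show "com e \<psi> \<otimes>\<^bsub>Homeo\<^esub> ?c = \<one>\<^bsub>Homeo\<^esub>"
      by (simp add: com_def fun_eq_iff)
    show "?c \<in> carrier Homeo" using \<open>?c \<in> \<Gamma> (Suc i)\<close> \<Gamma>_subset_G in_Homeo by blast
    have "com e \<psi> = inv\<^bsub>Homeo\<^esub> e \<otimes>\<^bsub>Homeo\<^esub> inv\<^bsub>Homeo\<^esub> \<psi> \<otimes>\<^bsub>Homeo\<^esub> e \<otimes>\<^bsub>Homeo\<^esub> \<psi>" by (simp add: com_def)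
    then show "com e \<psi> \<in> carrier Homeo"
      using in_Homeo[OF eG] in_Homeo[OF assms(2)] by (metis Homeo.inv_closed Homeo.m_closed)
  qed
  ultimately show ?thesis by simp
qed

text \<open>These sets are the stages of the descent: for \<open>j = N\<close> only invariance under
  \<open>\<phi>\<close> is demanded, for \<open>j = 0\<close> and \<open>\<phi> \<in> G\<close>
  invariance under all of \<open>G\<close>.\<close>

abbreviation inv_means :: "(torus \<Rightarrow> torus) \<Rightarrow> nat \<Rightarrow> ((torus \<Rightarrow> real) \<Rightarrow> real) set" where
  "inv_means \<phi> j \<equiv> invariant_means (insert \<phi> (\<Gamma> j))"

lemma com_in_\<Gamma>:
  assumes "\<phi> \<in> G" "\<psi> \<in> \<Gamma> j" "s \<in> insert \<phi> (\<Gamma> (Suc j))"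
  shows "s \<in> G" "com s \<psi> \<in> \<Gamma> (Suc j)"
proof -
  have \<psi>: "\<psi> \<in> G" using assms(2) \<Gamma>_subset_G by blast
  show "s \<in> G" using assms \<Gamma>_subset_G by blast
  show "com s \<psi> \<in> \<Gamma> (Suc j)"
    using assms com_in_\<Gamma>_right[OF assms(1,2)] com_in_\<Gamma>_left[of s "Suc j" \<psi>] \<psi>
      \<Gamma>_antimono[of "Suc j" "Suc (Suc j)"] by auto
qed

text \<open>Exchanging the two pullbacks costs a factor \<open>pullback (com e \<psi>)\<close> next
  to \<open>L\<close>, and \<open>L\<close> absorbs it.\<close>

lemma pullback_commutator:
  assumes "e \<in> G" "\<psi> \<in> G" "L \<circ> pullback (com e \<psi>) = L"
  shows "L \<circ> pullback \<psi> \<circ> pullback e = L \<circ> pullback e \<circ> pullback \<psi>"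
proof -
  have "pullback \<psi> \<circ> pullback e = pullback (com e \<psi>) \<circ> (pullback e \<circ> pullback \<psi>)"
    by (simp only: pullback_comp com_eq[OF assms(1,2)] comp_assoc)
  then have "L \<circ> (pullback \<psi> \<circ> pullback e) = (L \<circ> pullback (com e \<psi>)) \<circ> (pullback e \<circ> pullback \<psi>)"
    by (simp only: comp_assoc)
  then show ?thesis by (simp only: assms(3) comp_assoc)
qed

text \<open>The commutators of \<open>\<psi>\<close> with \<open>\<phi>\<close> and with
  \<open>\<Gamma> (Suc j)\<close> lie in \<open>\<Gamma> (Suc j)\<close>, under which
  \<open>L\<close> is invariant. Hence pulling back by \<open>\<psi>\<close> keeps all the
  invariances of \<open>L\<close>.\<close>

lemma inv_means_pullback:
  assumes \<phi>: "\<phi> \<in> G" and \<psi>: "\<psi> \<in> \<Gamma> j" and L: "L \<in> inv_means \<phi> (Suc j)"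
  shows "L \<circ> pullback \<psi> \<in> inv_means \<phi> (Suc j)"
proof -
  have \<psi>G: "\<psi> \<in> G" using \<psi> \<Gamma>_subset_G by blast
  have "L \<circ> pullback \<psi> \<circ> pullback s = L \<circ> pullback \<psi>" if s: "s \<in> insert \<phi> (\<Gamma> (Suc j))" for s
  proof -
    note s' = com_in_\<Gamma>[OF \<phi> \<psi> s]
    have inv: "L \<circ> pullback (com s \<psi>) = L" "L \<circ> pullback s = L"
      using L s s'(2) by (auto simp: invariant_means_def)
    show ?thesis using pullback_commutator[OF s'(1) \<psi>G inv(1)] unfolding inv(2) .
  qed
  then show ?thesis
    using L means_pullback_Homeo[OF in_Homeo[OF \<psi>G]] by (auto simp: invariant_means_def)
qed

text \<open>Backward induction along the lower central series, which ends at the identity.\<close>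

lemma commutator_induct:
  assumes \<phi>: "\<phi> \<in> G" and \<psi>: "\<psi> \<in> \<Gamma> j" and id: "Q id"
    and step: "\<And>e. e \<in> insert \<phi> (\<Gamma> (Suc j)) \<Longrightarrow> Q (com e \<psi>) \<Longrightarrow> Q e"
  shows "Q \<phi>"
proof -
  have \<psi>G: "\<psi> \<in> G" using \<psi> \<Gamma>_subset_G by blast
  \<comment> \<open>The maximum ensures that the level \<open>Suc j\<close>, which contains
    \<open>com \<phi> \<psi>\<close>, is reached even if \<open>N\<close> is smaller.\<close>
  define M where "M = max N (Suc j)"
  have all: "\<forall>e\<in>\<Gamma> i. Q e" if "Suc j \<le> i" "i \<le> M" for i
    using that(2,1)
  proof (induction rule: inc_induct)
    case base
    have "\<Gamma> M \<subseteq> {id}" using \<Gamma>_antimono[of N M] nilpotent by (simp add: M_def)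
    then show ?case using id by blast
  next
    case (step n)
    show ?case
    proof
      fix e assume e: "e \<in> \<Gamma> n"
      then have "e \<in> insert \<phi> (\<Gamma> (Suc j))" using step.prems \<Gamma>_antimono by blast
      moreover have "Q (com e \<psi>)" using step com_in_\<Gamma>_left[OF e \<psi>G] by auto
      ultimately show "Q e" by (rule assms(4))
    qed
  qed
  have "Suc j \<le> M" by (simp add: M_def)
  then have "Q (com \<phi> \<psi>)" using all[OF order_refl] com_in_\<Gamma>_right[OF \<phi> \<psi>] by blast
  then show ?thesis by (rule step[rotated]) simp
qed

text \<open>Markov-Kakutani is applied to \<open>\<Gamma> j\<close> acting on the means with
  rotation vector \<open>v\<close>. The hypothesis \<open>const\<close> keeps this set stable, and
  commutators within \<open>\<Gamma> j\<close> lie in \<open>\<Gamma> (Suc j)\<close>, so the action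
  is commutative.\<close>

lemma invariant_means_step:
  assumes \<phi>: "\<phi> \<in> G" and L0: "L0 \<in> inv_means \<phi> (Suc j)" "mean_rotation L0 F = v"
    and const: "\<And>\<psi> L. \<psi> \<in> \<Gamma> j \<Longrightarrow> L \<in> inv_means \<phi> (Suc j) \<Longrightarrow>
      mean_rotation (L \<circ> pullback \<psi>) F = mean_rotation L F"
  shows "\<exists>L\<in>inv_means \<phi> j. mean_rotation L F = v"
proof -
  define K where "K = {L \<in> inv_means \<phi> (Suc j). mean_rotation L F = v}"
  have "\<exists>L\<in>K. \<forall>\<tau>\<in>pullback ` \<Gamma> j. L \<circ> \<tau> = L"
  proof (rule markov_kakutani)
    show "compact K" "convex_functions K"
      unfolding K_def by (rule compact_invariant_means convex_invariant_means)+
    show "K \<noteq> {}" using L0 by (auto simp: K_def)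
    show "L \<circ> \<tau> \<in> K" if "L \<in> K" "\<tau> \<in> pullback ` \<Gamma> j" for L \<tau>
      using that const inv_means_pullback[OF \<phi>] unfolding K_def by blast
    fix L \<sigma> \<tau> assume L: "L \<in> K" and "\<sigma> \<in> pullback ` \<Gamma> j" "\<tau> \<in> pullback ` \<Gamma> j"
    then obtain s t where s: "s \<in> \<Gamma> j" "\<sigma> = pullback s" and t: "t \<in> \<Gamma> j" "\<tau> = pullback t"
      by blast
    have "s \<in> G" "t \<in> G" using s t \<Gamma>_subset_G by blast+
    moreover have "L \<circ> pullback (com t s) = L"
      using L com_in_\<Gamma>_right[OF \<open>t \<in> G\<close> s(1)] unfolding K_def invariant_means_def by blast
    ultimately show "L \<circ> \<sigma> \<circ> \<tau> = L \<circ> \<tau> \<circ> \<sigma>"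
      unfolding s(2) t(2) by (intro pullback_commutator)
  qed
  then obtain L where "L \<in> K" "\<And>\<psi>. \<psi> \<in> \<Gamma> j \<Longrightarrow> L \<circ> pullback \<psi> = L" by blast
  then have "L \<in> inv_means \<phi> j" "mean_rotation L F = v"
    by (auto simp: K_def invariant_means_def)
  then show ?thesis by blast
qed

text \<open>The range of \<open>e\<close> is the one of \<open>commutator_induct\<close>;
  \<open>w\<close> and \<open>E'\<close> are chosen once for all means, so the formula can be
  iterated and subtracted.\<close>

lemma mean_rotation_step:
  assumes \<phi>: "\<phi> \<in> G" "acts_linearly (mat 1) \<phi>" and \<psi>: "\<psi> \<in> \<Gamma> j" "acts_linearly B \<psi>"
    and e: "e \<in> insert \<phi> (\<Gamma> (Suc j))" and E: "is_lift E e"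
  obtains w E' where "acts_linearly (mat 1) e" "is_lift E' (com e \<psi>)"
    "\<forall>L\<in>inv_means \<phi> (Suc j).
      mean_rotation (L \<circ> pullback \<psi>) E = B *v (mean_rotation L E + mean_rotation L E') + w"
proof -
  note c = com_in_\<Gamma>[OF \<phi>(1) \<psi>(1) e]
  have \<psi>G: "\<psi> \<in> G" using \<psi> \<Gamma>_subset_G by blast
  have act: "acts_linearly (mat 1) e" "acts_linearly (mat 1) (com e \<psi>)"
    using e \<phi>(2) \<Gamma>_acts_trivially c(2) by blast+
  obtain E' where E': "is_lift E' (com e \<psi>)" using act(2) unfolding acts_linearly_def by blast
  obtain w where w: "\<And>L. L \<in> means \<Longrightarrow> L \<circ> pullback e = L \<Longrightarrow> L \<circ> pullback (com e \<psi>) = L \<Longrightarrow>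
      mean_rotation (L \<circ> pullback \<psi>) E = B *v (mean_rotation L E + mean_rotation L E') + w"
    using mean_rotation_pullback[OF com_eq[OF c(1) \<psi>G] \<psi>(2) act E E'] by blast
  show thesis
    by (rule that[OF act(1) E'], rule ballI, rule w)
      (use c(2) e in \<open>auto simp: invariant_means_def simp del: lower_central_series.simps\<close>)
qed

text \<open>By induction the rotation vector of the commutator is constant along the orbit
  \<open>M k\<close> of push-forwards of \<open>L\<close>. The rotation vectors of \<open>E\<close>
  then follow an affine recursion with linear part \<open>B\<close>, and they are bounded.\<close>

lemma mean_rotation_unipotent:
  assumes \<phi>: "\<phi> \<in> G" "acts_linearly (mat 1) \<phi>" "is_lift F \<phi>"
    and \<psi>: "\<psi> \<in> \<Gamma> j" "acts_linearly B \<psi>" and unip: "(B - mat 1) ** (B - mat 1) = 0"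
    and L: "L \<in> inv_means \<phi> (Suc j)"
  shows "mean_rotation (L \<circ> pullback \<psi>) F = mean_rotation L F"
proof -
  \<comment> \<open>All lifts and all means are quantified, since the induction passes to the lift
    \<open>E'\<close> and to the push-forwards of \<open>L\<close>.\<close>
  define Q where "Q e \<longleftrightarrow> (\<forall>E L. is_lift E e \<longrightarrow> L \<in> inv_means \<phi> (Suc j) \<longrightarrow>
    mean_rotation (L \<circ> pullback \<psi>) E = mean_rotation L E)" for e
  note stable = inv_means_pullback[OF \<phi>(1) \<psi>(1)]
  have "Q \<phi>"
  proof (rule commutator_induct[OF \<phi>(1) \<psi>(1)])
    show "Q id"
      unfolding Q_def
    proof (intro allI impI)
      fix E L assume E: "is_lift E id" and L: "L \<in> inv_means \<phi> (Suc j)"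
      obtain w where "\<And>L. L \<in> means \<Longrightarrow> mean_rotation L E = w"
        using mean_rotation_identity[OF E] by blast
      then show "mean_rotation (L \<circ> pullback \<psi>) E = mean_rotation L E"
        using L stable[OF L] unfolding invariant_means_def by simp
    qed
  next
    fix e assume e: "e \<in> insert \<phi> (\<Gamma> (Suc j))" and Qc: "Q (com e \<psi>)"
    show "Q e"
      unfolding Q_def
    proof (intro allI impI)
      fix E L assume E: "is_lift E e" and L: "L \<in> inv_means \<phi> (Suc j)"
      obtain w E' where act: "acts_linearly (mat 1) e" and E': "is_lift E' (com e \<psi>)"
        and step: "\<forall>L\<in>inv_means \<phi> (Suc j).
          mean_rotation (L \<circ> pullback \<psi>) E = B *v (mean_rotation L E + mean_rotation L E') + w"
        by (rule mean_rotation_step[OF \<phi>(1,2) \<psi> e E]) blast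
      note w = bspec[OF step]
      obtain C where C: "\<And>L. L \<in> means \<Longrightarrow> norm (mean_rotation L E) \<le> C"
        using mean_rotation_bounded[OF act E] by blast
      define M where "M k = ((\<lambda>L. L \<circ> pullback \<psi>) ^^ k) L" for k
      have M_Suc: "M (Suc k) = M k \<circ> pullback \<psi>" for k by (simp add: M_def)
      have M: "M k \<in> inv_means \<phi> (Suc j)" for k
        by (induction k) (use L stable in \<open>simp_all only: M_Suc, simp add: M_def\<close>)
      have ME': "mean_rotation (M k) E' = mean_rotation L E'" for k
      proof (induction k)
        case (Suc k)
        then show ?case using Qc E' M[of k] unfolding Q_def M_Suc by metis
      qed (simp add: M_def)
      have "mean_rotation (M (Suc 0)) E = mean_rotation (M 0) E"
      proof (rule bounded_unipotent_orbit_constant[OF _ _ unip])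
        show "mean_rotation (M (Suc k)) E = B *v mean_rotation (M k) E + (B *v mean_rotation L E' + w)" for k
          unfolding M_Suc w[OF M] ME' by (simp add: matrix_vector_right_distrib)
        show "norm (mean_rotation (M k) E) \<le> C" for k
          using C M[of k] by (simp add: invariant_means_def)
      qed
      then show "mean_rotation (L \<circ> pullback \<psi>) E = mean_rotation L E"
        unfolding M_Suc by (simp only: M_def funpow_0)
    qed
  qed
  then show ?thesis using \<phi>(3) L unfolding Q_def by blast
qed

text \<open>A single hyperbolic \<open>\<psi>\<close> forces one common rotation vector on all means
  in \<open>inv_means \<phi> (Suc 0)\<close>. In differences of two means the constant
  \<open>w\<close> cancels, and so does the commutator term, by induction.\<close>

lemma mean_rotation_hyperbolic:
  assumes \<phi>: "\<phi> \<in> G" "acts_linearly (mat 1) \<phi>" "is_lift F \<phi>"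
    and \<psi>: "\<psi> \<in> G" "acts_linearly B \<psi>"
    and B: "det B * det B = 1" "\<bar>(B$1$1 + B$2$2)^2 - 2 * det B\<bar> \<ge> 3"
    and L: "L \<in> inv_means \<phi> (Suc 0)" "L' \<in> inv_means \<phi> (Suc 0)"
  shows "mean_rotation L F = mean_rotation L' F"
proof -
  define Q where "Q e \<longleftrightarrow> (\<forall>E L L'. is_lift E e \<longrightarrow> L \<in> inv_means \<phi> (Suc 0) \<longrightarrow>
    L' \<in> inv_means \<phi> (Suc 0) \<longrightarrow> mean_rotation L E = mean_rotation L' E)" for e
  have \<psi>0: "\<psi> \<in> \<Gamma> 0" "inv\<^bsub>Homeo\<^esub> \<psi> \<in> \<Gamma> 0"
    using \<psi>(1) subgroup.m_inv_closed[OF subgroup_G] by simp_all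
  note stable = inv_means_pullback[OF \<phi>(1)]
  have "Q \<phi>"
  proof (rule commutator_induct[OF \<phi>(1) \<psi>0(1)])
    show "Q id"
      unfolding Q_def invariant_means_def using mean_rotation_identity by (metis (lifting) mem_Collect_eq)
  next
    fix e assume e: "e \<in> insert \<phi> (\<Gamma> (Suc 0))" and Qc: "Q (com e \<psi>)"
    show "Q e"
      unfolding Q_def
    proof (intro allI impI)
      fix E L L' assume E: "is_lift E e" and L: "L \<in> inv_means \<phi> (Suc 0)" "L' \<in> inv_means \<phi> (Suc 0)"
      obtain w E' where act: "acts_linearly (mat 1) e" and E': "is_lift E' (com e \<psi>)"
        and step: "\<forall>L\<in>inv_means \<phi> (Suc 0).
          mean_rotation (L \<circ> pullback \<psi>) E = B *v (mean_rotation L E + mean_rotation L E') + w"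
        by (rule mean_rotation_step[OF \<phi>(1,2) \<psi>0(1) \<psi>(2) e E]) blast
      note w = bspec[OF step]
      obtain C where C: "\<And>L. L \<in> means \<Longrightarrow> norm (mean_rotation L E) \<le> C"
        using mean_rotation_bounded[OF act E] by blast
      define \<Delta> where "\<Delta> = {mean_rotation L E - mean_rotation L' E | L L'.
        L \<in> inv_means \<phi> (Suc 0) \<and> L' \<in> inv_means \<phi> (Suc 0)}"
      have pull: "mean_rotation (L \<circ> pullback \<psi>) E - mean_rotation (L' \<circ> pullback \<psi>) E
          = B *v (mean_rotation L E - mean_rotation L' E)"
        if "L \<in> inv_means \<phi> (Suc 0)" "L' \<in> inv_means \<phi> (Suc 0)" for L L'
      proof -
        have "mean_rotation L E' = mean_rotation L' E'" using Qc E' that unfolding Q_def by blast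
        then show ?thesis
          unfolding w[OF that(1)] w[OF that(2)]
          by (simp add: matrix_vector_right_distrib matrix_vector_mult_diff_distrib)
      qed
      have "mean_rotation L E - mean_rotation L' E = 0"
      proof (rule hyperbolic_bounded_invariant_zero[OF B, of \<Delta>])
        show "mean_rotation L E - mean_rotation L' E \<in> \<Delta>" using L unfolding \<Delta>_def by blast
        show "norm d \<le> C + C" if d: "d \<in> \<Delta>" for d
        proof -
          obtain M M' where "d = mean_rotation M E - mean_rotation M' E" "M \<in> means" "M' \<in> means"
            using d unfolding \<Delta>_def invariant_means_def by blast
          then show ?thesis using norm_triangle_ineq4 add_mono[OF C C] order_trans by metis
        qed
        fix d assume "d \<in> \<Delta>"
        then obtain M M' where d: "d = mean_rotation M E - mean_rotation M' E"
          and M: "M \<in> inv_means \<phi> (Suc 0)" "M' \<in> inv_means \<phi> (Suc 0)"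
          unfolding \<Delta>_def by blast
        show "B *v d \<in> \<Delta>"
          unfolding \<Delta>_def d pull[OF M, symmetric] using stable[OF \<psi>0(1)] M by blast
        \<comment> \<open>Each mean is the push-forward under \<open>\<psi>\<close> of a mean in the
          same stable set; this gives backward invariance of \<open>\<Delta>\<close>.\<close>
        have undo: "M \<circ> pullback (inv\<^bsub>Homeo\<^esub> \<psi>) \<circ> pullback \<psi> = M" for M
        proof -
          have "M \<circ> pullback (inv\<^bsub>Homeo\<^esub> \<psi>) \<circ> pullback \<psi> = M \<circ> pullback (\<psi> \<circ> inv\<^bsub>Homeo\<^esub> \<psi>)"
            by (simp only: comp_assoc pullback_comp)
          then show ?thesis
            by (simp only: Homeo_inverse(2)[OF in_Homeo[OF \<psi>(1)]] pullback_id)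
        qed
        note M' = stable[OF \<psi>0(2) M(1)] stable[OF \<psi>0(2) M(2)]
        have "d = B *v (mean_rotation (M \<circ> pullback (inv\<^bsub>Homeo\<^esub> \<psi>)) E
            - mean_rotation (M' \<circ> pullback (inv\<^bsub>Homeo\<^esub> \<psi>)) E)"
          unfolding pull[OF M', symmetric] undo d ..
        then show "\<exists>d'\<in>\<Delta>. d = B *v d'" using M' unfolding \<Delta>_def by blast
      qed
      then show "mean_rotation L E = mean_rotation L' E" by simp
    qed
  qed
  then show ?thesis using \<phi>(3) L unfolding Q_def by blast
qed

text \<open>The descent runs from \<open>j = N\<close>, where \<open>L0\<close> itself qualifies, to
  \<open>j = 0\<close>. At positive levels \<open>\<psi>\<close> acts by the identity matrix and the
  unipotent case applies; only the last step relies on \<open>const\<close>.\<close>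

lemma invariant_means_descend:
  assumes \<phi>: "\<phi> \<in> G" "acts_linearly (mat 1) \<phi>" "is_lift F \<phi>"
    and L0: "L0 \<in> means" "L0 \<circ> pullback \<phi> = L0"
    and const: "\<And>\<psi> L. \<psi> \<in> G \<Longrightarrow> L \<in> inv_means \<phi> (Suc 0) \<Longrightarrow>
      mean_rotation (L \<circ> pullback \<psi>) F = mean_rotation L F"
  shows "\<exists>L\<in>inv_means \<phi> 0. mean_rotation L F = mean_rotation L0 F"
proof -
  have "\<exists>L\<in>inv_means \<phi> j. mean_rotation L F = mean_rotation L0 F" if "0 \<le> j" "j \<le> N" for j
    using that(2,1)
  proof (induction rule: inc_induct)
    case base
    have "L0 \<in> inv_means \<phi> N"
      unfolding nilpotent invariant_means_def using L0 pullback_id[of L0] by blast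
    then show ?case by blast
  next
    case (step j)
    then obtain L where L: "L \<in> inv_means \<phi> (Suc j)" "mean_rotation L F = mean_rotation L0 F" by auto
    show ?case
    proof (rule invariant_means_step[OF \<phi>(1) L])
      fix \<psi> L assume \<psi>: "\<psi> \<in> \<Gamma> j" and L: "L \<in> inv_means \<phi> (Suc j)"
      show "mean_rotation (L \<circ> pullback \<psi>) F = mean_rotation L F"
      proof (cases j)
        case 0
        then show ?thesis using const \<psi> L by simp
      next
        case (Suc i)
        then have "acts_linearly (mat 1) \<psi>" using \<psi> \<Gamma>_acts_trivially by blast
        then show ?thesis by (rule mean_rotation_unipotent[OF \<phi> \<psi> _ _ L]) simp
      qed
    qed
  qed
  then show ?thesis by blast
qed

text \<open>Displacements are continuous, so agreement of \<open>L\<close> and \<open>\<mu>\<close>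
  on continuous functions is enough; this fits both \<open>integral_mean\<close> and the
  representing measure.\<close>

lemma rotation_vector_eq_mean_rotation:
  assumes \<phi>: "acts_linearly (mat 1) \<phi>" "is_lift F \<phi>"
    and \<mu>: "prob_space \<mu>" "sets \<mu> = sets borel"
    and eq: "\<And>f. continuous_on UNIV f \<Longrightarrow> L f = integral\<^sup>L \<mu> f"
  shows "rotation_vector \<mu> F = mean_rotation L F"
proof -
  interpret prob_space \<mu> by fact
  note cont = continuous_displacement[OF \<phi>]
  have "bounded (range (displacement F))"
    using compact_continuous_image[OF cont compact_torus] by (rule compact_imp_bounded)
  then obtain C where "\<And>p. norm (displacement F p) \<le> C" by (auto simp: bounded_iff)
  moreover have "displacement F \<in> borel_measurable \<mu>"
    using borel_measurable_continuous_onI[OF cont] by (simp add: measurable_cong_sets[OF \<mu>(2) refl])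
  ultimately have "integrable \<mu> (displacement F)"
    by (intro integrable_const_bound[of _ C]) auto
  then have "rotation_vector \<mu> F $ i = (\<integral>p. displacement F p $ i \<partial>\<mu>)" for i
    unfolding rotation_vector_def
    by (rule integral_bounded_linear[OF bounded_linear_vec_nth, symmetric])
  moreover have "continuous_on UNIV (\<lambda>p. displacement F p $ i)" for i
    using cont by (intro continuous_intros)
  ultimately show ?thesis
    by (simp add: vec_eq_iff mean_rotation_def mean_vector_def eq)
qed

lemma group_invariant_measure:
  assumes \<phi>: "acts_linearly (mat 1) \<phi>" "is_lift F \<phi>" and L: "L \<in> invariant_means G"
  obtains \<nu> where "\<nu> \<in> group_inv_measures G" "rotation_vector \<nu> F = mean_rotation L F"
proof -
  have LG: "L \<in> means" "\<And>g. g \<in> G \<Longrightarrow> L \<circ> pullback g = L"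
    using L by (auto simp: invariant_means_def)
  interpret compact_mean L by unfold_locales (rule LG compact_torus)+
  have "repr \<in> group_inv_measures G"
    unfolding group_inv_measures_def inv_measures_def
    using prob_space_repr sets_repr repr_invariant[OF Homeo_inverse(1)[OF in_Homeo] LG(2)] by blast
  moreover have "rotation_vector repr F = mean_rotation L F"
    by (rule rotation_vector_eq_mean_rotation[OF \<phi> prob_space_repr sets_repr integral_repr[symmetric]])
  ultimately show thesis by (rule that)
qed

lemma integral_mean_invariant:
  assumes "\<phi> \<in> G" "\<mu> \<in> inv_measures \<phi>"
  shows "integral_mean \<mu> \<circ> pullback \<phi> = integral_mean \<mu>"
proof
  fix f :: "torus \<Rightarrow> real"
  have \<mu>: "sets \<mu> = sets borel" "distr \<mu> borel \<phi> = \<mu>" using assms(2) by (auto simp: inv_measures_def)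
  note hom = Homeo_inverse(1)[OF in_Homeo[OF assms(1)]]
  have meas: "\<phi> \<in> measurable \<mu> borel"
    using hom by (auto simp: homeomorphism_def measurable_cong_sets[OF \<mu>(1) refl] intro: borel_measurable_continuous_onI)
  have "integral\<^sup>L \<mu> (pullback \<phi> f) = integral\<^sup>L \<mu> f" if "f \<in> bounded_borel"
    using integral_distr[OF meas, of f] that by (simp add: \<mu>(2) pullback_def comp_def bounded_borel_def)
  then show "(integral_mean \<mu> \<circ> pullback \<phi>) f = integral_mean \<mu> f"
    by (simp add: integral_mean_def bounded_borel_pullback_iff[OF hom])
qed

text \<open>The lift is kept: its rotation vector for a \<open>\<phi>\<close>-invariant measure
  reappears at a mean invariant under \<open>G\<close>, and hence at a measure in
  \<open>group_inv_measures G\<close>, where it is zero.\<close>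

lemma group_irrotational_subset:
  assumes const: "\<And>\<phi> F \<psi> L. \<phi> \<in> G \<Longrightarrow> acts_linearly (mat 1) \<phi> \<Longrightarrow> is_lift F \<phi> \<Longrightarrow> \<psi> \<in> G \<Longrightarrow>
    L \<in> inv_means \<phi> (Suc 0) \<Longrightarrow> mean_rotation (L \<circ> pullback \<psi>) F = mean_rotation L F"
  shows "group_irrotational G \<subseteq> irrotational G"
proof
  fix \<phi> assume "\<phi> \<in> group_irrotational G"
  then obtain F where \<phi>: "\<phi> \<in> isotopic_to_id_part G" and F: "is_lift F \<phi>"
    and zero: "\<And>\<nu>. \<nu> \<in> group_inv_measures G \<Longrightarrow> rotation_vector \<nu> F = 0"
    by (auto simp: group_irrotational_def)
  have G: "\<phi> \<in> G" and "isotopic \<phi> id" using \<phi> by (auto simp: isotopic_to_id_part_def)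
  moreover have "toral_aut (mat 1) = id" by (simp add: fun_eq_iff toral_aut_one)
  ultimately have act: "acts_linearly (mat 1) \<phi>"
    using isotopic_acts_linearly[of \<phi> "mat 1"] by (simp add: map_matrix_mat_1)
  have "rotation_vector \<mu> F = 0" if \<mu>: "\<mu> \<in> inv_measures \<phi>" for \<mu>
  proof -
    have prob: "prob_space \<mu>" "sets \<mu> = sets borel" using \<mu> by (auto simp: inv_measures_def)
    obtain L where L: "L \<in> inv_means \<phi> 0" "mean_rotation L F = mean_rotation (integral_mean \<mu>) F"
      using invariant_means_descend[OF G act F integral_mean_in_means[OF prob] integral_mean_invariant[OF G \<mu>]]
        const[OF G act F] by blast
    have "L \<in> invariant_means G" using L(1) by (auto simp: invariant_means_def)
    then have "mean_rotation L F = 0"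
      using group_invariant_measure[OF act F] zero by metis
    moreover have "rotation_vector \<mu> F = mean_rotation (integral_mean \<mu>) F"
      by (rule rotation_vector_eq_mean_rotation[OF act F prob])
        (simp add: integral_mean_def bounded_borel_continuous[OF compact_torus])
    ultimately show ?thesis using L(2) by simp
  qed
  then show "\<phi> \<in> irrotational G" using \<phi> F by (auto simp: irrotational_def)
qed

end

lemma irrotational_subset: "irrotational G \<subseteq> group_irrotational G"
proof
  fix \<phi> assume \<phi>: "\<phi> \<in> irrotational G"
  then have "group_inv_measures G \<subseteq> inv_measures \<phi>"
    by (auto simp: irrotational_def isotopic_to_id_part_def group_inv_measures_def)
  with \<phi> show "\<phi> \<in> group_irrotational G"
    unfolding irrotational_def group_irrotational_def by (simp, metis subsetD)
qed

section \<open>Integer matrices\<close>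

interpretation GL2Z: group GL2Z by (rule group_GL2Z)

lemma GL2Z_simps [simp]: "A \<otimes>\<^bsub>GL2Z\<^esub> B = A ** B" "\<one>\<^bsub>GL2Z\<^esub> = mat 1"
  by (simp_all add: GL2Z_def)

lemma GL2Z_inverse:
  assumes "A \<in> carrier GL2Z"
  shows "A ** inv\<^bsub>GL2Z\<^esub> A = mat 1" "inv\<^bsub>GL2Z\<^esub> A ** A = mat 1"
  using GL2Z.r_inv[OF assms] GL2Z.l_inv[OF assms] by simp_all

lemma generate_centralizes:
  assumes S: "S \<subseteq> carrier GL2Z" and comm: "\<And>s. s \<in> S \<Longrightarrow> Z ** s = s ** Z"
    and "B \<in> generate GL2Z S"
  shows "Z ** B = B ** Z"
  using assms(3)
proof (induction rule: generate.induct)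
  case (inv s)
  then have s: "s \<in> carrier GL2Z" using S by blast
  note i = GL2Z_inverse[OF s]
  have "Z ** inv\<^bsub>GL2Z\<^esub> s = (inv\<^bsub>GL2Z\<^esub> s ** s) ** Z ** inv\<^bsub>GL2Z\<^esub> s" by (simp add: i)
  also have "\<dots> = inv\<^bsub>GL2Z\<^esub> s ** (s ** Z) ** inv\<^bsub>GL2Z\<^esub> s" by (simp only: matrix_mul_assoc)
  also have "\<dots> = inv\<^bsub>GL2Z\<^esub> s ** Z ** (s ** inv\<^bsub>GL2Z\<^esub> s)"
    by (simp only: comm[OF inv, symmetric] matrix_mul_assoc)
  finally show ?case by (simp add: i)
next
  case (eng A B)
  have "Z ** (A ** B) = (A ** Z) ** B" by (simp only: eng.IH(1)[symmetric] matrix_mul_assoc)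
  also have "\<dots> = A ** B ** Z" by (simp only: eng.IH(2) matrix_mul_assoc[symmetric])
  finally show ?case by simp
qed (simp_all add: comm)

lemma generate_commute:
  assumes S: "S \<subseteq> carrier GL2Z" and comm: "\<And>s t. s \<in> S \<Longrightarrow> t \<in> S \<Longrightarrow> s ** t = t ** s"
    and "A \<in> generate GL2Z S" "B \<in> generate GL2Z S"
  shows "A ** B = B ** A"
proof -
  have "s ** A = A ** s" if "s \<in> S" for s
    using generate_centralizes[OF S _ assms(3)] comm that by blast
  then show ?thesis using generate_centralizes[OF S _ assms(4), of A] by metis
qed

text \<open>By reflexivity \<open>toral_aut B\<close> belongs to its own class, hence to that of
  \<open>g\<close>, which provides the isotopy from \<open>g\<close>.\<close>

lemma matrix_class_acts_linearly:
  assumes "mapping_class g = matrix_class B" "B \<in> carrier GL2Z"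
  shows "acts_linearly (map_matrix real_of_int B) g"
proof -
  have "isotopic (toral_aut B) (toral_aut B)"
    using toral_aut_in_Homeo[OF assms(2)]
    by (simp add: isotopic_def homotopic_with_refl continuous_toral_aut)
  then have "toral_aut B \<in> mapping_class g"
    unfolding assms(1) by (simp add: matrix_class_def mapping_class_def)
  then show ?thesis
    by (intro isotopic_acts_linearly) (simp add: mapping_class_def)
qed

lemma matrix_add_rdistrib: "(A + B) ** C = A ** C + B ** C"
  for A B :: "'a::semiring_1^'n^'m" and C :: "'a^'k^'n"
  by (simp add: vec_eq_iff matrix_matrix_mult_def sum.distrib algebra_simps)

text \<open>The standard twist is the identity plus a matrix of square zero, and conjugation
  preserves this form.\<close>

lemma dehn_twist_nilpotent_part:
  assumes "dehn_twist D"
  obtains N where "D \<in> carrier GL2Z" "D = mat 1 + N" "N ** N = 0"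
proof -
  define V :: "int \<Rightarrow> int^2^2" where "V m = vector [vector [1, 0], vector [m, 1]]" for m
  define M :: "int \<Rightarrow> int^2^2" where "M m = vector [vector [0, 0], vector [m, 0]]" for m
  obtain P m where P: "P \<in> carrier GL2Z" and D: "D = P ** V m ** inv\<^bsub>GL2Z\<^esub> P"
    using assms by (auto simp: dehn_twist_def V_def)
  note i = GL2Z_inverse[OF P]
  have V: "V m = mat 1 + M m"
    by (simp add: V_def M_def vec_eq_iff forall_2 mat_def)
  have MM: "M m ** M m = 0"
    by (simp add: M_def vec_eq_iff forall_2 matrix_matrix_mult_def sum_2)
  define N where "N = P ** M m ** inv\<^bsub>GL2Z\<^esub> P"
  have "V m ** V (- m) = mat 1" "V (- m) ** V m = mat 1"
    by (simp_all add: V_def vec_eq_iff forall_2 matrix_matrix_mult_def sum_2 mat_def)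
  then have "V m \<in> carrier GL2Z" by (auto simp: GL2Z_def invertible_def)
  then have "D \<in> carrier GL2Z"
    using P GL2Z.m_closed[OF GL2Z.m_closed[OF P] GL2Z.inv_closed[OF P]] by (simp add: D)
  moreover have "D = mat 1 + N"
    by (simp add: D V N_def matrix_add_ldistrib matrix_add_rdistrib i)
  moreover have "N ** N = P ** (M m ** (inv\<^bsub>GL2Z\<^esub> P ** P) ** M m) ** inv\<^bsub>GL2Z\<^esub> P"
    by (simp only: N_def matrix_mul_assoc)
  then have "N ** N = 0" by (simp add: i MM)
  ultimately show thesis by (rule that)
qed

text \<open>Since \<open>N\<close> has square zero, the matrices \<open>U k\<close>, the identity
  plus \<open>k\<close> times \<open>N\<close>, multiply by adding the indices. So they exhaust the
  group generated by \<open>D = U 1\<close>.\<close>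

lemma generate_dehn_twist:
  fixes N :: "int^2^2"
  assumes D: "D \<in> carrier GL2Z" "D = mat 1 + N" and N: "N ** N = 0"
    and B: "B \<in> generate GL2Z {D}"
  shows "(B - mat 1) ** (B - mat 1) = 0"
proof -
  have NN: "N$1$1 * N$1$1 + N$1$2 * N$2$1 = 0" "N$1$1 * N$1$2 + N$1$2 * N$2$2 = 0"
    "N$2$1 * N$1$1 + N$2$2 * N$2$1 = 0" "N$2$1 * N$1$2 + N$2$2 * N$2$2 = 0"
    using N by (simp_all add: vec_eq_iff forall_2 matrix_matrix_mult_def sum_2)
  define U where "U k = mat 1 + (\<chi> i j. k * N $ i $ j)" for k
  have U: "U k ** U l = U (k + l)" for k l
  proof -
    have "(1 + k * n11) * (1 + l * n11) + (k * n12) * (l * n21) = 1 + (k + l) * n11"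
      if "n11 * n11 + n12 * n21 = 0" for n11 n12 n21 :: int
      using that by algebra
    moreover have "(1 + k * n11) * (l * n12) + (k * n12) * (1 + l * n22) = (k + l) * n12"
      if "n11 * n12 + n12 * n22 = 0" for n11 n12 n22 :: int
      using that by algebra
    moreover have "(k * n21) * (1 + l * n11) + (1 + k * n22) * (l * n21) = (k + l) * n21"
      if "n21 * n11 + n22 * n21 = 0" for n11 n21 n22 :: int
      using that by algebra
    moreover have "(k * n21) * (l * n12) + (1 + k * n22) * (1 + l * n22) = 1 + (k + l) * n22"
      if "n21 * n12 + n22 * n22 = 0" for n12 n21 n22 :: int
      using that by algebra
    ultimately show ?thesis
      using NN by (simp add: U_def vec_eq_iff forall_2 matrix_matrix_mult_def sum_2 mat_def)
  qed
  have U0: "U 0 = mat 1" and U1: "U 1 = D" by (simp_all add: U_def D(2) vec_eq_iff)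
  have "\<exists>k. B = U k"
    using B
  proof (induction rule: generate.induct)
    case one
    then show ?case using U0 by (metis GL2Z_simps(2))
  next
    case (incl h)
    then show ?case using U1 by blast
  next
    case (inv h)
    have "inv\<^bsub>GL2Z\<^esub> D = U (-1)"
    proof (rule GL2Z.inv_equality)
      show "U (-1) \<otimes>\<^bsub>GL2Z\<^esub> D = \<one>\<^bsub>GL2Z\<^esub>" using U[of "-1" 1] by (simp add: U0 U1)
      show "U (-1) \<in> carrier GL2Z"
        using U[of "-1" 1] U[of 1 "-1"] by (auto simp: GL2Z_def invertible_def U0)
    qed (rule D)
    with inv show ?case by blast
  next
    case (eng h1 h2)
    then show ?case using U by (metis GL2Z_simps(1))
  qed
  then obtain k where k: "B - mat 1 = (\<chi> i j. k * N $ i $ j)" by (auto simp: U_def)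
  have "(\<chi> i j. k * N $ i $ j) ** (\<chi> i j. k * N $ i $ j) = (\<chi> i j. (k * k) * (N ** N) $ i $ j)"
    by (simp add: vec_eq_iff matrix_matrix_mult_def sum_distrib_left mult_ac)
  then show ?thesis by (simp add: k N vec_eq_iff)
qed

lemma map_matrix_unipotent:
  assumes "(B - mat 1) ** (B - mat 1) = (0 :: int^2^2)"
  shows "(map_matrix real_of_int B - mat 1) ** (map_matrix real_of_int B - mat 1) = 0"
proof -
  have "map_matrix real_of_int B - mat 1 = map_matrix real_of_int (B - mat 1)"
    by (simp add: vec_eq_iff mat_def)
  then show ?thesis
    by (simp only: map_matrix_mult_of_int[symmetric] assms) (simp add: vec_eq_iff)
qed

text \<open>If \<open>A$1$2\<close> is nonzero, the first row suggests the eigenvector with entries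
  \<open>A$1$2\<close> and \<open>c - A$1$1\<close>, and the characteristic equation settles the
  second row. Otherwise \<open>A\<close> is lower triangular and its two diagonal entries are
  treated separately.\<close>

lemma root_in_spec:
  assumes "c * c - of_int (A$1$1 + A$2$2) * c + of_int (A$1$1 * A$2$2 - A$1$2 * A$2$1) = 0"
  shows "c \<in> spec A"
proof -
  have eig: "c \<in> spec A"
    if "x \<noteq> 0 \<or> y \<noteq> 0" "of_int (A$1$1) * x + of_int (A$1$2) * y = c * x"
      "of_int (A$2$1) * x + of_int (A$2$2) * y = c * y" for x y
    unfolding spec_def using that
    by (intro CollectI exI[of _ "vector [x, y]"])
      (auto simp: vec_eq_iff forall_2 matrix_vector_mult_def sum_2)
  consider "A$1$2 \<noteq> 0" | "A$1$2 = 0" "c = of_int (A$2$2)" | "A$1$2 = 0" "c \<noteq> of_int (A$2$2)" by blast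
  then show ?thesis
  proof cases
    case 1
    show ?thesis
    proof (rule eig[of "of_int (A$1$2)" "c - of_int (A$1$1)"])
      show "of_int (A$2$1) * of_int (A$1$2) + of_int (A$2$2) * (c - of_int (A$1$1)) = c * (c - of_int (A$1$1))"
        using assms by (simp add: algebra_simps)
    qed (use 1 in \<open>auto simp: algebra_simps\<close>)
  next
    case 2
    then show ?thesis by (intro eig[of 0 1]) auto
  next
    case 3
    then have "(c - of_int (A$1$1)) * (c - of_int (A$2$2)) = 0"
      using assms by (simp add: algebra_simps)
    with 3 have "c = of_int (A$1$1)" by simp
    with 3 show ?thesis
      by (intro eig[of "c - of_int (A$2$2)" "of_int (A$2$1)"]) (auto simp: algebra_simps)
  qed
qed

text \<open>The determinant is 1 or -1. For 1, a trace \<open>t\<close> with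
  \<open>t\<^sup>2 \<le> 4\<close> would give an eigenvalue on the unit circle, so
  \<open>t\<^sup>2 \<ge> 5\<close>. For -1, trace zero would give the eigenvalue 1, so
  \<open>t\<^sup>2 \<ge> 1\<close>.\<close>

lemma hyperbolic_det_trace:
  assumes A: "A \<in> carrier GL2Z" and spec: "\<And>c. c \<in> spec A \<Longrightarrow> cmod c \<noteq> 1"
  shows "det A * det A = 1" "\<bar>(A$1$1 + A$2$2)^2 - 2 * det A\<bar> \<ge> 3"
proof -
  have "det A * det (inv\<^bsub>GL2Z\<^esub> A) = 1"
    using GL2Z_inverse(1)[OF A] by (metis det_mul det_I)
  then have det: "det A = 1 \<or> det A = -1" by (metis zmult_eq_1_iff)
  then show "det A * det A = 1" by auto
  define t where "t = A$1$1 + A$2$2"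
  have root: "cmod c \<noteq> 1" if "c * c - of_int t * c + of_int (det A) = 0" for c
    using spec root_in_spec[of c A] that by (simp add: t_def det_2)
  show "\<bar>(A$1$1 + A$2$2)^2 - 2 * det A\<bar> \<ge> 3"
  proof (cases "det A = 1")
    case True
    have "\<not> t\<^sup>2 \<le> 4"
    proof
      assume "t\<^sup>2 \<le> 4"
      then have "real_of_int (t\<^sup>2) \<le> real_of_int 4" by (simp only: of_int_le_iff)
      then have t: "(real_of_int t)\<^sup>2 \<le> 4" by simp
      \<comment> \<open>\<open>Complex (t / 2) s\<close> is the root of
        \<open>c * c - t * c + 1\<close> in the closed upper half plane; its modulus is 1.\<close>
      define s where "s = sqrt (1 - (real_of_int t / 2)\<^sup>2)"
      have s: "s\<^sup>2 = 1 - (real_of_int t / 2)\<^sup>2" using t by (simp add: s_def power_divide)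
      have "cmod (Complex (t / 2) s) = 1" using s by (simp add: cmod_def)
      moreover have "Complex (t / 2) s * Complex (t / 2) s - of_int t * Complex (t / 2) s + of_int (det A) = 0"
        using s True by (simp add: complex_eq_iff power2_eq_square field_simps)
      ultimately show False using root by blast
    qed
    then show ?thesis using True by (simp add: t_def)
  next
    case False
    then have d: "det A = -1" using det by simp
    have "t \<noteq> 0" using root[of 1] d by auto
    then have "t\<^sup>2 \<ge> 1" by (metis int_one_le_iff_zero_less zero_less_power2)
    then show ?thesis using d by (simp add: t_def)
  qed
qed

section \<open>The four forms of \<open>[G]\<close>\<close>

theorem proposition4p7:
  fixes G :: "(torus \<Rightarrow> torus) set"
  assumes "nilpotent_subgroup G Homeo"
    and "mapping_class ` G = matrix_class ` {mat 1}
      \<or> (\<exists>D. dehn_twist D \<and> mapping_class ` G = matrix_class ` generate GL2Z {D})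
      \<or> (\<exists>A \<in> carrier GL2Z. (\<forall>c \<in> spec A. cmod c \<noteq> 1) \<and>
            (mapping_class ` G = matrix_class ` generate GL2Z {A}
             \<or> mapping_class ` G = matrix_class ` generate GL2Z {A, - mat 1}))"
  shows "irrotational G = group_irrotational G"
proof (rule antisym[OF irrotational_subset])
  let ?r = "map_matrix real_of_int :: int^2^2 \<Rightarrow> real^2^2"
  obtain n where sub: "subgroup G Homeo" and nil: "lower_central_series Homeo G n = {id}"
    using assms(1) by (auto simp: nilpotent_subgroup_def)
  have torus_group: "nilpotent_torus_group G n \<C>"
    if \<C>: "\<C> \<subseteq> carrier GL2Z" "mapping_class ` G = matrix_class ` \<C>"
      and comm: "\<And>A B. A \<in> \<C> \<Longrightarrow> B \<in> \<C> \<Longrightarrow> A ** B = B ** A" for \<C>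
  proof (rule nilpotent_torus_group.intro[OF sub nil])
    fix g assume "g \<in> G"
    then obtain B where "B \<in> \<C>" "mapping_class g = matrix_class B" using \<C>(2) by blast
    then show "\<exists>B\<in>\<C>. acts_linearly (?r B) g" using matrix_class_acts_linearly \<C>(1) by blast
  qed (rule comm)
  have unipotent: "group_irrotational G \<subseteq> irrotational G"
    if \<C>: "nilpotent_torus_group G n \<C>" and unip: "\<And>B. B \<in> \<C> \<Longrightarrow> (B - mat 1) ** (B - mat 1) = 0" for \<C>
  proof -
    interpret nilpotent_torus_group G n \<C> by (rule \<C>)
    show ?thesis
    proof (rule group_irrotational_subset)
      fix \<phi> F \<psi> L
      assume \<phi>: "\<phi> \<in> G" "acts_linearly (mat 1) \<phi>" "is_lift F \<phi>" and \<psi>: "\<psi> \<in> G"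
        and L: "L \<in> inv_means \<phi> (Suc 0)"
      obtain B where B: "B \<in> \<C>" "acts_linearly (?r B) \<psi>" using class_ex[OF \<psi>] by blast
      show "mean_rotation (L \<circ> pullback \<psi>) F = mean_rotation L F"
        by (rule mean_rotation_unipotent[OF \<phi> _ B(2) map_matrix_unipotent[OF unip[OF B(1)]] L])
          (simp add: \<psi>)
    qed
  qed
  from assms(2) show "group_irrotational G \<subseteq> irrotational G"
  proof (elim disjE exE conjE bexE)
    assume "mapping_class ` G = matrix_class ` {mat 1}"
    then show ?thesis
      by (intro unipotent[of "{mat 1}"] torus_group) (use GL2Z.one_closed in auto)
  next
    fix D assume D: "dehn_twist D" and G: "mapping_class ` G = matrix_class ` generate GL2Z {D}"
    obtain N where N: "D \<in> carrier GL2Z" "D = mat 1 + N" "N ** N = 0"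
      using dehn_twist_nilpotent_part[OF D] by blast
    show ?thesis
    proof (rule unipotent[OF torus_group])
      show "generate GL2Z {D} \<subseteq> carrier GL2Z" using N(1) by (intro GL2Z.generate_incl) simp
      show "mapping_class ` G = matrix_class ` generate GL2Z {D}" by (rule G)
      show "A ** B = B ** A" if "A \<in> generate GL2Z {D}" "B \<in> generate GL2Z {D}" for A B
        using generate_commute[of "{D}"] N(1) that by blast
    qed (rule generate_dehn_twist[OF N])
  next
    \<comment> \<open>The set \<open>S\<close> covers both hyperbolic forms: \<open>- mat 1\<close>
      commutes with \<open>A\<close>, and an element of \<open>G\<close> in the class of
      \<open>A\<close> supplies the hyperbolic action.\<close>
    have hyp: ?thesis
      if A: "A \<in> carrier GL2Z" and spec: "\<forall>c\<in>spec A. cmod c \<noteq> 1"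
        and S: "A \<in> S" "S \<subseteq> {A, - mat 1}" and G: "mapping_class ` G = matrix_class ` generate GL2Z S" for A S
    proof -
      have neg: "(- mat 1) ** X = - X" "X ** (- mat 1) = - X" for X :: "int^2^2"
        by (simp_all add: vec_eq_iff forall_2 matrix_matrix_mult_def sum_2 mat_def)
      have "(- mat 1 :: int^2^2) \<in> carrier GL2Z"
        by (auto simp: GL2Z_def invertible_def neg intro!: exI[of _ "- mat 1"])
      with A S have SC: "S \<subseteq> carrier GL2Z" by auto
      have comm: "s ** t = t ** s" if "s \<in> S" "t \<in> S" for s t
      proof -
        have "s = A \<or> s = - mat 1" "t = A \<or> t = - mat 1" using that S(2) by blast+
        then show ?thesis by (elim disjE) (simp_all only: neg)
      qed
      interpret nilpotent_torus_group G n "generate GL2Z S"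
        using GL2Z.generate_incl[OF SC] G generate_commute[OF SC comm] by (rule torus_group)
      have "A \<in> generate GL2Z S" using S(1) by (rule generate.incl)
      then obtain \<psi> where \<psi>: "\<psi> \<in> G" "mapping_class \<psi> = matrix_class A" using G by (metis imageE imageI)
      note act = matrix_class_acts_linearly[OF \<psi>(2) A]
      have "det (?r A) = real_of_int (det A)" by (simp add: det_2)
      then have hyp: "det (?r A) * det (?r A) = 1" "\<bar>(?r A $1$1 + ?r A $2$2)^2 - 2 * det (?r A)\<bar> \<ge> 3"
        using hyperbolic_det_trace[OF A] spec
        by (simp_all flip: of_int_mult of_int_add of_int_power of_int_diff of_int_abs)
      show ?thesis
      proof (rule group_irrotational_subset)
        fix \<phi> F \<psi>' L
        assume \<phi>: "\<phi> \<in> G" "acts_linearly (mat 1) \<phi>" "is_lift F \<phi>" and \<psi>': "\<psi>' \<in> G"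
          and L: "L \<in> inv_means \<phi> (Suc 0)"
        \<comment> \<open>The push-forward under \<open>\<psi>'\<close> is again in
          \<open>inv_means \<phi> (Suc 0)\<close>, so it has the common rotation vector, whatever
          the class of \<open>\<psi>'\<close>.\<close>
        show "mean_rotation (L \<circ> pullback \<psi>') F = mean_rotation L F"
          using inv_means_pullback[OF \<phi>(1) _ L, of \<psi>'] \<psi>'
          by (intro mean_rotation_hyperbolic[OF \<phi> \<psi>(1) act hyp _ L]) simp
      qed
    qed
    fix A assume "A \<in> carrier GL2Z" "\<forall>c\<in>spec A. cmod c \<noteq> 1"
    note hyp = hyp[OF this]
    show ?thesis if "mapping_class ` G = matrix_class ` generate GL2Z {A}"
      using that by (intro hyp[of "{A}"]) auto
    show ?thesis if "mapping_class ` G = matrix_class ` generate GL2Z {A, - mat 1}"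
      using that by (intro hyp[of "{A, - mat 1}"]) auto
  qed
qed

end
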